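(* Let $\beta>0$. Consider the bandit algorithm for tree search (defined in the context) run on the full binary tree of depth $D$ with the modified-UCT upper confidence bounds: for every node $i$ of depth $d$, $$B_{i,n_i} = X_{i,n_i} + (k_d+1)\sqrt{\frac{\log(\beta_{n_i}^{-1})}{2n_i}} + \frac{k'_d}{n_i},$$ where $$\beta_n=\frac{\beta}{2Nn(n+1)},\quad N=2^{D+1}-1,\quad k_d=\frac{1+\sqrt2}{\sqrt2}\left[(1+\sqrt2)^{D-d}-1\right],\quad k'_d=\frac{3^{D-d}-1}{2}.$$ Then, with probability at least $1-\beta$, for all $n\ge 1$, the cumulative pseudo-regret satisfies $$\bar R_n \le \frac{1+\sqrt2}{2}\left[(1+\sqrt2)^D-1\right]\sqrt{\log(\beta_n^{-1})\,n}+\frac{3^D-1}{2}.$$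
   Context: Setting. Consider the full binary tree of depth $D\ge1$ (the root has depth $0$, the $2^D$ leaves have depth $D$, every non-leaf node has two children, and $\mathcal C(i)$ denotes the set of children of $i$). To each leaf $i$ is assigned a random variable $X_i$ with values in $[0,1]$ and unknown law. Successive visits of leaf $i$ yield i.i.d. rewards $x_{i,1},x_{i,2},\dots$ distributed as $X_i$, and rewards of different leaves are independent. The value of a leaf is $\mu_i=\mathbb E X_i$. The value $\mu_i$ of a node $i$ is the maximum of the values of the leaves in the sub-tree rooted at $i$; $\mu^*$ is the value of the root, and $\Delta_i=\mu^*-\mu_i$. Algorithm. At each round $n=1,2,\dots$ a trajectory is run from the root to a leaf: starting at the root, from the current non-leaf node $i$ move to a child $j\in\mathcal C(i)$ having the highest bound $B_{j,n_j}$ among the children of $i$ (ties broken arbitrarily), where bounds are computed from the data of the previous rounds. On reaching a leaf $I_n$, the next reward sample $x_n$ of that leaf is received, and the number of visits of each node on the trajectory is incremented by one. A node that has not yet been visited has bound $+\infty$. Notation. $n_i=n_i(n)$ is the number of trajectories through node $i$ up to the current time $n$; $X_{i,n_i}$ is the empirical mean of the $n_i$ rewards obtained by the trajectories through node $i$. The cumulative pseudo-regret is $\bar R_n=n\mu^*-\sum_{t=1}^n\mu_{I_t}=\sum_{j \text{ leaf}} n_j(n)\Delta_j$. *)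

theory Defs
  imports "HOL-Probability.Probability" "HOL-Library.Sublist"
begin

text \<open>
  A node of the full binary tree of depth \<open>D\<close> is the list of left/right moves leading to it from
  the root. Hence the root is the empty list, the depth of a node is its length, the leaves are the
  lists of length \<open>D\<close>, and the sub-tree rooted at \<open>i\<close> consists of the extensions of \<open>i\<close>.
\<close>

type_synonym node = "bool list"

definition leaves :: "nat \<Rightarrow> node set" where
  "leaves D = {l. length l = D}"

definition children :: "node \<Rightarrow> node set" where
  "children i = {i @ [False], i @ [True]}"

text \<open>\<open>\<nu> l\<close> is the reward law of the leaf \<open>l\<close>.\<close>

definition leaf_value :: "(node \<Rightarrow> real measure) \<Rightarrow> node \<Rightarrow> real" where
  "leaf_value \<nu> l = (\<integral>x. x \<partial>\<nu> l)"

definition node_value :: "nat \<Rightarrow> (node \<Rightarrow> real measure) \<Rightarrow> node \<Rightarrow> real" where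
  "node_value D \<nu> i = Max (leaf_value \<nu> ` {l \<in> leaves D. prefix i l})"

text \<open>
  \<open>X l k\<close> (for \<open>k \<ge> 1\<close>) is the reward produced by the \<open>k\<close>-th visit of the leaf \<open>l\<close>. The random
  element \<open>U\<close>, with values in an arbitrary measurable space \<open>S\<close>, is the internal randomization
  available for breaking ties; a constant \<open>U\<close> gives deterministic tie-breaking.
\<close>

locale tree_bandit = prob_space M
  for M :: "'w measure" +
  fixes D :: nat
    and \<nu> :: "node \<Rightarrow> real measure"
    and X :: "node \<Rightarrow> nat \<Rightarrow> 'w \<Rightarrow> real"
    and S :: "'u measure"
    and U :: "'w \<Rightarrow> 'u"
  assumes bounded_rewards: "\<And>l. l \<in> leaves D \<Longrightarrow> AE x in \<nu> l. x \<in> {0..1}"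
    and identically_distributed:
      "\<And>l k. l \<in> leaves D \<Longrightarrow> k \<ge> 1 \<Longrightarrow> distr M borel (X l k) = \<nu> l"
    and independent:
      "indep_vars (\<lambda>_. borel) (\<lambda>(l, k). X l k) (leaves D \<times> {1..})"
    and randomization_measurable: "U \<in> measurable M S"
    and randomization_independent:
      "indep_set (sets (vimage_algebra (space M) U S))
         (sets (vimage_algebra (space M) (\<lambda>\<omega>. \<lambda>(l, k)\<in>leaves D \<times> {1..}. X l k \<omega>)
           (Pi\<^sub>M (leaves D \<times> {1..}) (\<lambda>_. borel))))"

text \<open>
  In the following, \<open>I t \<omega>\<close> is the leaf reached in round \<open>t \<ge> 1\<close>. A trajectory passes through the
  node \<open>i\<close> iff \<open>i\<close> is a prefix of the leaf it reaches.
\<close>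

definition visits :: "(nat \<Rightarrow> 'w \<Rightarrow> node) \<Rightarrow> node \<Rightarrow> nat \<Rightarrow> 'w \<Rightarrow> nat" where
  "visits I i n \<omega> = card {t \<in> {1..n}. prefix i (I t \<omega>)}"

definition reward ::
    "(node \<Rightarrow> nat \<Rightarrow> 'w \<Rightarrow> real) \<Rightarrow> (nat \<Rightarrow> 'w \<Rightarrow> node) \<Rightarrow> nat \<Rightarrow> 'w \<Rightarrow> real" where
  "reward X I t \<omega> = X (I t \<omega>) (visits I (I t \<omega>) t \<omega>) \<omega>"

definition empirical_mean ::
    "(node \<Rightarrow> nat \<Rightarrow> 'w \<Rightarrow> real) \<Rightarrow> (nat \<Rightarrow> 'w \<Rightarrow> node) \<Rightarrow> node \<Rightarrow> nat \<Rightarrow> 'w \<Rightarrow> real" where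
  "empirical_mean X I i n \<omega> =
     (\<Sum>t | t \<in> {1..n} \<and> prefix i (I t \<omega>). reward X I t \<omega>) / real (visits I i n \<omega>)"

text \<open>
  The leaf of round \<open>n\<close> is determined by the randomization and by the leaves and rewards of the
  rounds before \<open>n\<close>: it is measurable with respect to the sigma-algebra they generate.
\<close>

definition non_anticipating ::
    "'w measure \<Rightarrow> (node \<Rightarrow> nat \<Rightarrow> 'w \<Rightarrow> real) \<Rightarrow> 'u measure \<Rightarrow> ('w \<Rightarrow> 'u)
      \<Rightarrow> (nat \<Rightarrow> 'w \<Rightarrow> node) \<Rightarrow> bool" where
  "non_anticipating M X S U I \<longleftrightarrow>
     (\<forall>n\<ge>1. I n \<in> measurable
        (vimage_algebra (space M)
          (\<lambda>\<omega>. (U \<omega>, \<lambda>t\<in>{1..<n}. (I t \<omega>, reward X I t \<omega>)))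
          (S \<Otimes>\<^sub>M Pi\<^sub>M {1..<n} (\<lambda>_. count_space UNIV \<Otimes>\<^sub>M borel)))
        (count_space UNIV))"

text \<open>
  The leaf \<open>l\<close> is reached from the root by always moving to a child of maximal bound: \<open>take d l\<close> is
  the node of depth \<open>d\<close> on the path to \<open>l\<close>. If several leaves qualify, any of them is allowed.
\<close>

definition greedy_leaf :: "nat \<Rightarrow> (node \<Rightarrow> ereal) \<Rightarrow> node \<Rightarrow> bool" where
  "greedy_leaf D B l \<longleftrightarrow>
     l \<in> leaves D \<and> (\<forall>d<D. \<forall>j\<in>children (take d l). B j \<le> B (take (Suc d) l))"

text \<open>\<open>B i m x\<close> is the bound of node \<open>i\<close> after \<open>m\<close> visits with empirical mean \<open>x\<close>.\<close>

definition tree_search_run ::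
    "'w measure \<Rightarrow> nat \<Rightarrow> (node \<Rightarrow> nat \<Rightarrow> real \<Rightarrow> ereal) \<Rightarrow> (node \<Rightarrow> nat \<Rightarrow> 'w \<Rightarrow> real)
      \<Rightarrow> 'u measure \<Rightarrow> ('w \<Rightarrow> 'u) \<Rightarrow> (nat \<Rightarrow> 'w \<Rightarrow> node) \<Rightarrow> bool" where
  "tree_search_run M D B X S U I \<longleftrightarrow>
     non_anticipating M X S U I \<and>
     (\<forall>n\<ge>1. \<forall>\<omega>\<in>space M.
        greedy_leaf D
          (\<lambda>j. B j (visits I j (n - 1) \<omega>) (empirical_mean X I j (n - 1) \<omega>)) (I n \<omega>))"

definition beta_seq :: "nat \<Rightarrow> real \<Rightarrow> nat \<Rightarrow> real" where
  "beta_seq D \<beta> n = \<beta> / (2 * (2 ^ (D + 1) - 1) * real n * (real n + 1))"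

definition k_coeff :: "nat \<Rightarrow> nat \<Rightarrow> real" where
  "k_coeff D d = (1 + sqrt 2) / sqrt 2 * ((1 + sqrt 2) ^ (D - d) - 1)"

definition k'_coeff :: "nat \<Rightarrow> nat \<Rightarrow> real" where
  "k'_coeff D d = (3 ^ (D - d) - 1) / 2"

definition modified_uct_bound :: "nat \<Rightarrow> real \<Rightarrow> node \<Rightarrow> nat \<Rightarrow> real \<Rightarrow> ereal" where
  "modified_uct_bound D \<beta> i m x =
     (if m = 0 then \<infinity>
      else ereal (x
        + (k_coeff D (length i) + 1) * sqrt (ln (inverse (beta_seq D \<beta> m)) / (2 * real m))
        + k'_coeff D (length i) / real m))"

definition pseudo_regret ::
    "nat \<Rightarrow> (node \<Rightarrow> real measure) \<Rightarrow> (nat \<Rightarrow> 'w \<Rightarrow> node) \<Rightarrow> nat \<Rightarrow> 'w \<Rightarrow> real" where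
  "pseudo_regret D \<nu> I n \<omega> =
     real n * node_value D \<nu> [] - (\<Sum>t=1..n. node_value D \<nu> (I t \<omega>))"

end

theory Submission
  imports Defs
begin

text \<open>
  Attach to a node \<open>i\<close> of depth \<open>d\<close> the regret \<open>R\<^sub>i\<close> of its visits relative to its own
  value. By Azuma's inequality and a union bound over nodes, visit counts and signs, with probability
  at least \<open>1 - \<beta>\<close> the rewards collected below every node deviate in sum from the values of
  the visited leaves by at most \<open>c n = sqrt (n * ln (1 / \<beta>\<^sub>n) / 2)\<close>, where \<open>n\<close> is the visit count.
  On this event \<open>R\<^sub>i \<le> k\<^sub>d c n\<^sub>i + k'\<^sub>d\<close> by induction from the leaves to the root:
  this estimate for the better child makes its bound exceed its value, so whenever the
  worse child is chosen, the bound of the latter exceeds that value too; at the last such choice this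
  limits its regret relative to the better child by \<open>1 + (k\<^sub>d\<^sub>+\<^sub>1 + 2) c n + k'\<^sub>d\<^sub>+\<^sub>1\<close>. The two
  children combine because \<open>(c m)\<^sup>2 + (c n)\<^sup>2 \<le> (c (m + n))\<^sup>2\<close>.
\<close>

subsection \<open>Rounds through a node\<close>

definition rounds :: "(nat \<Rightarrow> 'w \<Rightarrow> node) \<Rightarrow> node \<Rightarrow> nat \<Rightarrow> 'w \<Rightarrow> nat set" where
  "rounds I i n \<omega> = {t \<in> {1..n}. prefix i (I t \<omega>)}"

lemma finite_rounds [simp]: "finite (rounds I i n \<omega>)"
  by (simp add: rounds_def)

lemma card_rounds [simp]: "card (rounds I i n \<omega>) = visits I i n \<omega>"
  by (simp add: rounds_def visits_def)

lemma rounds_0 [simp]: "rounds I i 0 \<omega> = {}"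
  by (simp add: rounds_def)

lemma visits_0 [simp]: "visits I i 0 \<omega> = 0"
  by (simp flip: card_rounds)

lemma rounds_Suc:
  "rounds I i (Suc n) \<omega> = (if prefix i (I (Suc n) \<omega>) then insert (Suc n) (rounds I i n \<omega>) else rounds I i n \<omega>)"
  by (auto simp: rounds_def le_Suc_eq)

lemma visits_Suc:
  "visits I i (Suc n) \<omega> = visits I i n \<omega> + of_bool (prefix i (I (Suc n) \<omega>))"
proof -
  have "Suc n \<notin> rounds I i n \<omega>" by (auto simp: rounds_def)
  then show ?thesis
    by (simp add: rounds_Suc flip: card_rounds)
qed

lemma visits_mono: "m \<le> n \<Longrightarrow> visits I i m \<omega> \<le> visits I i n \<omega>"
  unfolding card_rounds[symmetric] by (rule card_mono) (auto simp: rounds_def)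

lemma rounds_eq_empty_iff: "rounds I i n \<omega> = {} \<longleftrightarrow> visits I i n \<omega> = 0"
  by (metis card_rounds card_eq_0_iff finite_rounds)

lemma rounds_root: "rounds I [] n \<omega> = {1..n}"
  by (auto simp: rounds_def)

lemma visits_root: "visits I [] n \<omega> = n"
  by (simp add: rounds_root flip: card_rounds)

lemma visits_le: "visits I i n \<omega> \<le> n"
proof -
  have "card (rounds I i n \<omega>) \<le> card {1..n}" by (rule card_mono) (auto simp: rounds_def)
  then show ?thesis by simp
qed

text \<open>Isolates the last round \<open>t\<close> through a node. The choice in round
  \<open>t\<close> rests on the counts after round \<open>t - 1\<close>, so the regret of the node
  splits into that of round \<open>t\<close> and that accumulated when it was chosen.\<close>

lemma rounds_Max:
  assumes "visits I i n \<omega> > 0"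
  obtains t where "t \<ge> 1" "prefix i (I t \<omega>)" "t \<le> n"
    "rounds I i n \<omega> = insert t (rounds I i (t - 1) \<omega>)"
    "t \<notin> rounds I i (t - 1) \<omega>"
proof
  have ne: "rounds I i n \<omega> \<noteq> {}"
    using assms rounds_eq_empty_iff[of I i n \<omega>] by auto
  define t where "t = Max (rounds I i n \<omega>)"
  have t: "t \<in> rounds I i n \<omega>"
    unfolding t_def using ne by (intro Max_in) auto
  have le: "s \<le> t" if "s \<in> rounds I i n \<omega>" for s
    unfolding t_def using that by (intro Max_ge) auto
  show "t \<ge> 1" "prefix i (I t \<omega>)" "t \<le> n" using t by (auto simp: rounds_def)
  show "t \<notin> rounds I i (t - 1) \<omega>" using \<open>t \<ge> 1\<close> by (auto simp: rounds_def)
  show "rounds I i n \<omega> = insert t (rounds I i (t - 1) \<omega>)"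
    using t le by (force simp: rounds_def)
qed

subsection \<open>Confidence radii\<close>

lemma beta_seq_eq:
  "beta_seq D \<beta> n = \<beta> / (2 * (2 ^ (D + 1) - 1)) * (1 / (real n * (real n + 1)))"
  by (simp add: beta_seq_def algebra_simps)

lemma card_nodes_ge_1: "(1::real) \<le> 2 ^ (D + 1) - 1"
  using one_le_power[of "2::real" D] by simp

lemma beta_seq_pos: "0 < \<beta> \<Longrightarrow> n \<ge> 1 \<Longrightarrow> 0 < beta_seq D \<beta> n"
  unfolding beta_seq_def using card_nodes_ge_1[of D]
  by (intro divide_pos_pos mult_pos_pos; linarith)

lemma beta_seq_antimono:
  assumes "0 < \<beta>" "1 \<le> m" "m \<le> n"
  shows "beta_seq D \<beta> n \<le> beta_seq D \<beta> m"
proof -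
  have "1 / (real n * (real n + 1)) \<le> 1 / (real m * (real m + 1))"
    using assms by (intro divide_left_mono mult_mono mult_pos_pos) auto
  moreover have "0 \<le> \<beta> / (2 * (2 ^ (D + 1) - 1))"
    using card_nodes_ge_1[of D] assms by (intro divide_nonneg_nonneg mult_nonneg_nonneg; linarith)
  ultimately show ?thesis
    unfolding beta_seq_eq by (rule mult_left_mono)
qed

lemma ln_beta_seq_mono:
  assumes "0 < \<beta>" "1 \<le> m" "m \<le> n"
  shows "ln (inverse (beta_seq D \<beta> m)) \<le> ln (inverse (beta_seq D \<beta> n))"
  using beta_seq_antimono[OF assms, of D] beta_seq_pos[of \<beta> m D] beta_seq_pos[of \<beta> n D] assms
  by (simp add: ln_inverse)

text \<open>For \<beta> \<le> 1 the denominator of \<open>beta_seq\<close> is at least its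
  numerator, so the radii are square roots of nonnegative numbers.\<close>

lemma ln_beta_seq_nonneg:
  assumes "0 < \<beta>" "\<beta> \<le> 1" "1 \<le> n"
  shows "0 \<le> ln (inverse (beta_seq D \<beta> n))"
proof -
  have "1 * 1 * 1 * 1 \<le> 2 * (2 ^ (D + 1) - 1) * real n * (real n + 1)"
    using card_nodes_ge_1[of D] assms by (intro mult_mono mult_nonneg_nonneg; linarith)
  then have "beta_seq D \<beta> n \<le> 1"
    unfolding beta_seq_def using assms by (simp add: divide_le_eq_1)
  then show ?thesis
    using beta_seq_pos[of \<beta> n D] assms by (simp add: ln_inverse)
qed

text \<open>Telescoping, since 1/(n(n+1)) = 1/n - 1/(n+1). The sum is the failure budget of one
  node, an equal share of \<beta> among all nodes; the factor 2 pays for the two signs of a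
  deviation.\<close>

lemma beta_seq_sums: "(\<lambda>m. 2 * beta_seq D \<beta> (Suc m)) sums (\<beta> / (2 ^ (D + 1) - 1))"
proof -
  have "(\<lambda>m. inverse (real (Suc m)) - inverse (real (Suc (Suc m)))) sums (inverse (real (Suc 0)) - 0)"
    by (rule telescope_sums'[OF LIMSEQ_inverse_real_of_nat])
  then have "(\<lambda>m. \<beta> / (2 ^ (D + 1) - 1) * (inverse (real (Suc m)) - inverse (real (Suc (Suc m))))) sums
    (\<beta> / (2 ^ (D + 1) - 1) * 1)"
    by (intro sums_mult) simp
  moreover have "\<beta> / (2 ^ (D + 1) - 1) * (inverse (real (Suc m)) - inverse (real (Suc (Suc m))))
    = 2 * beta_seq D \<beta> (Suc m)" for m
  proof -
    have "inverse (real (Suc m)) - inverse (real (Suc (Suc m))) = 1 / (real (Suc m) * (real (Suc m) + 1))"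
      by (simp add: field_simps)
    moreover have "\<beta> / K * x = 2 * (\<beta> / (2 * K) * x)" for K x :: real by simp
    moreover have "real (Suc m) + 1 = real (Suc (Suc m))" by simp
    ultimately show ?thesis unfolding beta_seq_eq by metis
  qed
  ultimately show ?thesis by simp
qed

text \<open>Hoeffding's radius for a sum of \<open>n\<close> rewards instead of their mean: it is
  the \<open>c\<close> for which exp(-2 c^2 / n) equals \<open>beta_seq D \<beta> n\<close>.\<close>

definition conf :: "nat \<Rightarrow> real \<Rightarrow> nat \<Rightarrow> real" where
  "conf D \<beta> n = sqrt (real n * ln (inverse (beta_seq D \<beta> n)) / 2)"

lemma conf_0 [simp]: "conf D \<beta> 0 = 0"
  by (simp add: conf_def)

lemma conf_nonneg:
  assumes "0 < \<beta>" "\<beta> \<le> 1"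
  shows "0 \<le> conf D \<beta> n"
  using ln_beta_seq_nonneg[OF assms, of n D] by (cases "n = 0") (simp_all add: conf_def)

lemma conf_sq:
  assumes "0 < \<beta>" "\<beta> \<le> 1"
  shows "(conf D \<beta> n)\<^sup>2 = real n * ln (inverse (beta_seq D \<beta> n)) / 2"
  using assms ln_beta_seq_nonneg[of \<beta> n D]
  by (cases "n = 0") (auto simp: conf_def)

lemma conf_eq:
  assumes "1 \<le> n"
  shows "real n * sqrt (ln (inverse (beta_seq D \<beta> n)) / (2 * real n)) = conf D \<beta> n"
proof -
  have "real n * sqrt (ln (inverse (beta_seq D \<beta> n)) / (2 * real n))
      = sqrt ((real n)\<^sup>2 * (ln (inverse (beta_seq D \<beta> n)) / (2 * real n)))"
    by (subst real_sqrt_mult) simp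
  then show ?thesis using assms by (simp add: conf_def power2_eq_square)
qed

text \<open>The square is \<open>n\<close> times a nondecreasing logarithm, so both logarithms may
  be raised to the one at \<open>m + n\<close>. Hence the radii of siblings combine like orthogonal
  lengths.\<close>

lemma conf_sq_add:
  assumes "0 < \<beta>" "\<beta> \<le> 1"
  shows "(conf D \<beta> m)\<^sup>2 + (conf D \<beta> n)\<^sup>2 \<le> (conf D \<beta> (m + n))\<^sup>2"
proof -
  have *: "real m * ln (inverse (beta_seq D \<beta> m)) \<le> real m * ln (inverse (beta_seq D \<beta> (m + n)))" for m n
    using ln_beta_seq_mono[of \<beta> m "m + n" D] assms
    by (cases "m = 0") (auto intro!: mult_left_mono)
  show ?thesis
    using *[of m n] *[of n m] by (simp add: conf_sq[OF assms] field_simps)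
qed

lemma conf_mono:
  assumes "0 < \<beta>" "\<beta> \<le> 1" "m \<le> n"
  shows "conf D \<beta> m \<le> conf D \<beta> n"
proof (rule power2_le_imp_le)
  show "(conf D \<beta> m)\<^sup>2 \<le> (conf D \<beta> n)\<^sup>2"
    using order_trans[OF _ conf_sq_add[OF assms(1,2), of D m "n - m"]] assms(3) by simp
qed (use conf_nonneg assms in auto)

section \<open>Recursion of the coefficients along the depth\<close>

lemma k_coeff_leaf [simp]: "k_coeff D D = 0" and k'_coeff_leaf [simp]: "k'_coeff D D = 0"
  by (simp_all add: k_coeff_def k'_coeff_def)

lemma k_coeff_nonneg: "0 \<le> k_coeff D d"
  by (auto simp: k_coeff_def)

lemma k'_coeff_nonneg: "0 \<le> k'_coeff D d"
  by (auto simp: k'_coeff_def)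

lemma k_coeff_step:
  assumes "d < D"
  shows "k_coeff D d = (1 + sqrt 2) * (k_coeff D (Suc d) + 1)"
proof -
  have "D - d = Suc (D - Suc d)" using assms by simp
  then show ?thesis
    by (simp add: k_coeff_def field_simps)
qed

lemma k'_coeff_step:
  assumes "d < D"
  shows "k'_coeff D d = 3 * k'_coeff D (Suc d) + 1"
proof -
  have "D - d = Suc (D - Suc d)" using assms by simp
  then show ?thesis
    by (simp add: k'_coeff_def field_simps)
qed

text \<open>Induction step for the radii, with \<open>m\<close> visits of the better child and
  \<open>n\<close> of the other. By Cauchy-Schwarz and \<open>conf_sq_add\<close> the two radii add
  up to at most sqrt 2 times that of the parent.\<close>

lemma k_coeff_conf_step:
  assumes "d < D" "0 < \<beta>" "\<beta> \<le> 1"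
  shows "k_coeff D (Suc d) * conf D \<beta> m + (k_coeff D (Suc d) + 2) * conf D \<beta> n
    \<le> k_coeff D d * conf D \<beta> (m + n)"
proof -
  let ?a = "conf D \<beta> m" and ?b = "conf D \<beta> n" and ?c = "conf D \<beta> (m + n)" and ?k = "k_coeff D (Suc d)"
  have c: "0 \<le> ?c" using assms conf_nonneg by auto
  have "(?a + ?b)\<^sup>2 \<le> 2 * (?a\<^sup>2 + ?b\<^sup>2)"
    using zero_le_power2[of "?a - ?b"] by (simp add: power2_eq_square algebra_simps)
  also have "\<dots> \<le> (sqrt 2 * ?c)\<^sup>2"
    using conf_sq_add[OF assms(2,3), of D m n] by (simp add: power_mult_distrib)
  finally have ab: "?a + ?b \<le> sqrt 2 * ?c"
    using c by (auto intro: power2_le_imp_le)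
  have b: "?b \<le> ?c" using conf_mono assms by auto
  have s: "1 \<le> sqrt 2" by simp
  have "?k * ?a + (?k + 2) * ?b = ?k * (?a + ?b) + 2 * ?b" by (simp add: algebra_simps)
  also have "\<dots> \<le> ?k * (sqrt 2 * ?c) + 2 * ?c"
    using ab b k_coeff_nonneg by (intro add_mono mult_left_mono) auto
  \<comment> \<open>Both sqrt 2 and 2 are raised to 1 + sqrt 2, the common factor in the recursion
    of \<open>k_coeff\<close>.\<close>
  also have "\<dots> \<le> ?k * ((1 + sqrt 2) * ?c) + (1 + sqrt 2) * ?c"
    using c s k_coeff_nonneg by (intro add_mono mult_left_mono mult_right_mono) auto
  also have "\<dots> = k_coeff D d * ?c"
    using k_coeff_step[OF assms(1)] by (simp add: algebra_simps)
  finally show ?thesis .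
qed

subsection \<open>The tree\<close>

lemma card_nodes: "card {i :: node. length i \<le> D} = 2 ^ (D + 1) - 1"
  and finite_nodes: "finite {i :: node. length i \<le> D}"
proof -
  have "card {i :: node. length i \<le> D} = (\<Sum>d\<le>D. 2 ^ d)"
    using card_lists_length_le[of "UNIV :: bool set" D] by simp
  also have "\<dots> = 2 ^ (D + 1) - 1"
    by (induction D) auto
  finally show "card {i :: node. length i \<le> D} = 2 ^ (D + 1) - 1" .
  show "finite {i :: node. length i \<le> D}"
    using finite_lists_length_le[of "UNIV :: bool set" D] by simp
qed

lemma prefix_leaf: "l \<in> leaves D \<Longrightarrow> l' \<in> leaves D \<Longrightarrow> prefix l l' \<longleftrightarrow> l = l'"
  by (auto simp: leaves_def prefix_def)

lemma finite_leaves [simp]: "finite (leaves D)"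
  using finite_lists_length_eq[of "UNIV :: bool set" D] by (simp add: leaves_def)

lemma ex_leaf_above:
  assumes "length i \<le> D"
  shows "{l \<in> leaves D. prefix i l} \<noteq> {}"
proof -
  have "i @ replicate (D - length i) False \<in> {l \<in> leaves D. prefix i l}"
    using assms by (simp add: leaves_def)
  then show ?thesis by blast
qed

lemma node_value_leaf: "l \<in> leaves D \<Longrightarrow> node_value D \<nu> l = leaf_value \<nu> l"
proof -
  assume l: "l \<in> leaves D"
  then have "{l' \<in> leaves D. prefix l l'} = {l}" using prefix_leaf[OF l] by auto
  then show ?thesis by (simp add: node_value_def)
qed

text \<open>Written with a bit and its negation so that the better child can be named first,
  whichever it is.\<close>

lemma leaves_below_split:
  assumes "length i < D"
  shows "{l \<in> leaves D. prefix i l} =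
    {l \<in> leaves D. prefix (i @ [b]) l} \<union> {l \<in> leaves D. prefix (i @ [\<not> b]) l}"
proof -
  have "prefix i l \<longleftrightarrow> prefix (i @ [b]) l \<or> prefix (i @ [\<not> b]) l" if l: "l \<in> leaves D" for l
  proof
    assume "prefix i l"
    then obtain zs where zs: "l = i @ zs" by (auto simp: prefix_def)
    with l assms obtain z zs' where "zs = z # zs'" by (cases zs) (auto simp: leaves_def)
    with zs show "prefix (i @ [b]) l \<or> prefix (i @ [\<not> b]) l" by (cases "z = b") auto
  qed (auto simp: prefix_def)
  then show ?thesis by blast
qed

lemma not_both_children: "\<not> (prefix (i @ [b]) l \<and> prefix (i @ [\<not> b]) l)"
  by (auto simp: prefix_def)

lemma node_value_child:
  assumes "length i < D"
  obtains b where "node_value D \<nu> (i @ [b]) = node_value D \<nu> i"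
proof -
  have "node_value D \<nu> i \<in> leaf_value \<nu> ` {l \<in> leaves D. prefix i l}"
    unfolding node_value_def using ex_leaf_above[of i D] assms by (intro Max_in) auto
  then obtain l b where l: "l \<in> leaves D" "prefix (i @ [b]) l" "node_value D \<nu> i = leaf_value \<nu> l"
    using leaves_below_split[OF assms, of True] by auto
  have "node_value D \<nu> (i @ [b]) = node_value D \<nu> i"
  proof (rule antisym)
    show "node_value D \<nu> i \<le> node_value D \<nu> (i @ [b])"
      unfolding l(3) unfolding node_value_def using l by (intro Max_ge) auto
    show "node_value D \<nu> (i @ [b]) \<le> node_value D \<nu> i"
      unfolding node_value_def using l by (intro Max_mono) (auto simp: prefix_def)
  qed
  then show thesis by (rule that)
qed

text \<open>Localizes the path condition at the node \<open>i\<close>; this is the only comparison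
  of bounds that the regret analysis uses.\<close>

lemma greedy_leaf_child:
  assumes "greedy_leaf D B l" "prefix (i @ [b]) l"
  shows "B (i @ [\<not> b]) \<le> B (i @ [b])"
proof -
  have "length l = D" and *: "\<forall>d<D. \<forall>j\<in>children (take d l). B j \<le> B (take (Suc d) l)"
    using assms(1) by (auto simp: greedy_leaf_def leaves_def)
  moreover obtain zs where l: "l = i @ b # zs" using assms(2) by (auto simp: prefix_def)
  ultimately have "length i < D" by auto
  moreover have "i @ [\<not> b] \<in> children (take (length i) l)"
    by (cases b) (auto simp: l children_def)
  ultimately have "B (i @ [\<not> b]) \<le> B (take (Suc (length i)) l)" using * by blast
  then show ?thesis by (simp add: l)
qed

subsection \<open>Regret of a node on the concentration event\<close>

text \<open>Purely pathwise: \<open>\<omega>\<close> is fixed and chance enters only through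
  \<open>conc\<close>. That hypothesis compares rewards with the values of the leaves actually
  visited; the gap from there to the value of the node is what the induction controls.\<close>

lemma node_regret_bound:
  assumes \<beta>: "0 < \<beta>" "\<beta> \<le> 1"
    and greedy: "\<And>n. n \<ge> 1 \<Longrightarrow> greedy_leaf D
      (\<lambda>j. modified_uct_bound D \<beta> j (visits I j (n - 1) \<omega>) (empirical_mean X I j (n - 1) \<omega>)) (I n \<omega>)"
    and unit: "\<And>l. l \<in> leaves D \<Longrightarrow> leaf_value \<nu> l \<in> {0..1}"
    and conc: "\<And>i n. length i \<le> D \<Longrightarrow>
      \<bar>\<Sum>t\<in>rounds I i n \<omega>. reward X I t \<omega> - leaf_value \<nu> (I t \<omega>)\<bar> \<le> conf D \<beta> (visits I i n \<omega>)"
    and i: "length i \<le> D"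
  shows "(\<Sum>t\<in>rounds I i n \<omega>. node_value D \<nu> i - leaf_value \<nu> (I t \<omega>))
    \<le> k_coeff D (length i) * conf D \<beta> (visits I i n \<omega>) + k'_coeff D (length i)"
  using i
proof (induction "D - length i" arbitrary: i n)
  case 0
  then have l: "length i = D" by simp
  have "node_value D \<nu> i - leaf_value \<nu> (I t \<omega>) = 0" if "t \<in> rounds I i n \<omega>" for t
  proof -
    have "I t \<omega> \<in> leaves D" using greedy[of t] that by (auto simp: greedy_leaf_def rounds_def)
    then have "I t \<omega> = i" using that l prefix_leaf[of i D "I t \<omega>"] by (auto simp: rounds_def leaves_def)
    then show ?thesis using node_value_leaf[of i D \<nu>] l by (simp add: leaves_def)
  qed
  then have "(\<Sum>t\<in>rounds I i n \<omega>. node_value D \<nu> i - leaf_value \<nu> (I t \<omega>)) = 0"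
    by (intro sum.neutral) auto
  then show ?case by (simp add: l)
next
  case (Suc h)
  define \<mu> where "\<mu> = node_value D \<nu> i"
  define d where "d = length i"
  have d: "d < D" using Suc d_def by simp
  obtain b where b: "node_value D \<nu> (i @ [b]) = \<mu>"
    using node_value_child[of i D \<nu>] d unfolding d_def \<mu>_def by blast
  define j where "j = i @ [b]"
  define j' where "j' = i @ [\<not> b]"
  have len: "length j = Suc d" "length j' = Suc d" by (auto simp: j_def j'_def d_def)
  let ?k = "k_coeff D (Suc d)" and ?k' = "k'_coeff D (Suc d)"
  have leaf: "I t \<omega> \<in> leaves D" if "t \<in> rounds I i n \<omega>" for t i n
    using greedy[of t] that by (auto simp: greedy_leaf_def rounds_def)
  \<comment> \<open>Every round passes through the root, so \<open>leaf\<close> at \<open>[]\<close>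
    applies to all rounds.\<close>
  have split: "rounds I i n \<omega> = rounds I j n \<omega> \<union> rounds I j' n \<omega>" for n
    using leaves_below_split[of i D b] leaf[of _ "[]" n] d d_def by (auto simp: rounds_def j_def j'_def)
  have disj: "rounds I j n \<omega> \<inter> rounds I j' n \<omega> = {}" for n
    using not_both_children[of i b] by (auto simp: rounds_def j_def j'_def)
  have visits: "visits I i n \<omega> = visits I j n \<omega> + visits I j' n \<omega>" for n
    unfolding card_rounds[symmetric] split using disj by (intro card_Un_disjoint) auto
  have IH: "(\<Sum>t\<in>rounds I j n \<omega>. \<mu> - leaf_value \<nu> (I t \<omega>)) \<le> ?k * conf D \<beta> (visits I j n \<omega>) + ?k'" for n
    using Suc(1)[of j n] Suc(2) len d b d_def by (auto simp: j_def)
  have emp: "real (visits I i n \<omega>) * empirical_mean X I i n \<omega> = (\<Sum>t\<in>rounds I i n \<omega>. reward X I t \<omega>)" for i n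
    using rounds_eq_empty_iff[of I i n \<omega>] unfolding empirical_mean_def rounds_def[symmetric]
    by (cases "visits I i n \<omega> = 0") simp_all
  \<comment> \<open>A single round costs at most 1. This pays for the last round through
    \<open>j'\<close>, which the comparison of bounds does not cover.\<close>
  have \<mu>1: "\<mu> - leaf_value \<nu> l \<le> 1" if "l \<in> leaves D" for l
  proof -
    have "\<mu> \<in> leaf_value \<nu> ` {l \<in> leaves D. prefix i l}"
      unfolding \<mu>_def node_value_def using ex_leaf_above[of i D] d d_def by (intro Max_in) auto
    then have "\<mu> \<le> 1" using unit by fastforce
    then show ?thesis using unit[OF that] by simp
  qed
  have other: "(\<Sum>t\<in>rounds I j' n \<omega>. \<mu> - leaf_value \<nu> (I t \<omega>))
      \<le> 1 + (?k + 2) * conf D \<beta> (visits I j' n \<omega>) + ?k'" (is "?L \<le> _")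
  proof (cases "visits I j' n \<omega> = 0")
    case True
    then show ?thesis using rounds_eq_empty_iff[of I j' n \<omega>] k'_coeff_nonneg by simp
  next
    case False
    then obtain t where t: "t \<ge> 1" "prefix j' (I t \<omega>)" "t \<le> n"
      "rounds I j' n \<omega> = insert t (rounds I j' (t - 1) \<omega>)" "t \<notin> rounds I j' (t - 1) \<omega>"
      using rounds_Max[of I j' n \<omega>] by blast
    let ?m = "visits I j (t - 1) \<omega>" and ?m' = "visits I j' (t - 1) \<omega>"
    have "?L = (\<mu> - leaf_value \<nu> (I t \<omega>)) + (\<Sum>s\<in>rounds I j' (t - 1) \<omega>. \<mu> - leaf_value \<nu> (I s \<omega>))"
      using t by simp
    also have "\<mu> - leaf_value \<nu> (I t \<omega>) \<le> 1"
      using greedy[of t] t by (intro \<mu>1) (auto simp: greedy_leaf_def)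
    also have "(\<Sum>s\<in>rounds I j' (t - 1) \<omega>. \<mu> - leaf_value \<nu> (I s \<omega>)) \<le> (?k + 2) * conf D \<beta> ?m' + ?k'"
    proof (cases "?m' = 0")
      case True
      then show ?thesis using rounds_eq_empty_iff[of I j' "t - 1" \<omega>] k'_coeff_nonneg by simp
    next
      case m': False
      define B where "B i = empirical_mean X I i (t - 1) \<omega>
        + (?k + 1) * sqrt (ln (inverse (beta_seq D \<beta> (visits I i (t - 1) \<omega>))) / (2 * real (visits I i (t - 1) \<omega>)))
        + ?k' / real (visits I i (t - 1) \<omega>)" for i
      have le: "modified_uct_bound D \<beta> j ?m (empirical_mean X I j (t - 1) \<omega>)
        \<le> modified_uct_bound D \<beta> j' ?m' (empirical_mean X I j' (t - 1) \<omega>)"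
        using greedy_leaf_child[OF greedy[OF t(1)], of i "\<not> b"] t(2) by (simp add: j_def j'_def)
      \<comment> \<open>An unvisited \<open>j\<close> would have bound \<infinity>, above the finite
        bound of the visited \<open>j'\<close>.\<close>
      then have m: "?m \<noteq> 0" using m' by (auto simp: modified_uct_bound_def split: if_splits)
      have BB: "B j \<le> B j'"
        using le m m' by (simp add: modified_uct_bound_def B_def len)
      have mB: "real (visits I i (t - 1) \<omega>) * B i
          = (\<Sum>s\<in>rounds I i (t - 1) \<omega>. reward X I s \<omega>) + (?k + 1) * conf D \<beta> (visits I i (t - 1) \<omega>) + ?k'"
        if "visits I i (t - 1) \<omega> \<noteq> 0" for i
        using that emp[of i "t - 1"] conf_eq[of "visits I i (t - 1) \<omega>" D \<beta>]
        unfolding B_def by (simp add: distrib_left mult.left_commute)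
      \<comment> \<open>Optimism: in the bonus of \<open>j\<close>, the part with \<open>?k\<close>
        and \<open>?k'\<close> covers the regret of \<open>j\<close> by induction, and the one extra
        radius covers the deviation of its rewards.\<close>
      have "real ?m * \<mu> \<le> (\<Sum>s\<in>rounds I j (t - 1) \<omega>. leaf_value \<nu> (I s \<omega>)) + ?k * conf D \<beta> ?m + ?k'"
        using IH[of "t - 1"] by (simp add: sum_subtractf)
      also have "\<dots> \<le> real ?m * B j"
        unfolding mB[OF m] using conc[of j "t - 1"] len d by (simp add: sum_subtractf algebra_simps)
      finally have "\<mu> \<le> B j" using m by simp
      with BB have "real ?m' * \<mu> \<le> real ?m' * B j'" by (intro mult_left_mono) auto
      \<comment> \<open>The coefficient \<open>?k + 2\<close> collects \<open>?k + 1\<close> radii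
        from the bonus of \<open>j'\<close> and one for the deviation of its rewards.\<close>
      also have "\<dots> \<le> (\<Sum>s\<in>rounds I j' (t - 1) \<omega>. leaf_value \<nu> (I s \<omega>)) + (?k + 2) * conf D \<beta> ?m' + ?k'"
        unfolding mB[OF m'] using conc[of j' "t - 1"] len d by (simp add: sum_subtractf algebra_simps)
      finally show ?thesis by (simp add: sum_subtractf)
    qed
    also have "conf D \<beta> ?m' \<le> conf D \<beta> (visits I j' n \<omega>)"
      using \<beta> t by (intro conf_mono visits_mono) auto
    finally show ?thesis using k_coeff_nonneg[of D "Suc d"] by (simp add: mult_left_mono)
  qed
  have "(\<Sum>t\<in>rounds I i n \<omega>. \<mu> - leaf_value \<nu> (I t \<omega>))
    = (\<Sum>t\<in>rounds I j n \<omega>. \<mu> - leaf_value \<nu> (I t \<omega>)) + (\<Sum>t\<in>rounds I j' n \<omega>. \<mu> - leaf_value \<nu> (I t \<omega>))"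
    unfolding split using disj by (intro sum.union_disjoint) auto
  \<comment> \<open>The additive terms sum to \<open>2 * ?k' + 1\<close>; they are raised to
    \<open>3 * ?k' + 1\<close> to match the recursion of \<open>k'_coeff\<close>.\<close>
  also have "\<dots> \<le> ?k * conf D \<beta> (visits I j n \<omega>) + (?k + 2) * conf D \<beta> (visits I j' n \<omega>) + (3 * ?k' + 1)"
    using IH[of n] other k'_coeff_nonneg[of D "Suc d"] by simp
  also have "\<dots> \<le> k_coeff D d * conf D \<beta> (visits I i n \<omega>) + k'_coeff D d"
    unfolding visits k'_coeff_step[OF d] using k_coeff_conf_step[OF d \<beta>] by simp
  finally show ?case by (simp add: \<mu>_def d_def)
qed

subsection \<open>Independence of a reward from the others\<close>

text \<open>Stands in for conditioning on the past. The sigma-algebras generated by the two factors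
  lie in the two given independent ones, so the factors are independent random variables.\<close>

lemma (in prob_space) indep_set_nn_integral_mult:
  fixes H :: "'a \<Rightarrow> ennreal" and g :: "real \<Rightarrow> ennreal"
  assumes N: "space N = space M"
    and indep: "indep_set (sets N) (sets (vimage_algebra (space M) Y borel))"
    and H: "H \<in> borel_measurable N" and g: "g \<in> borel_measurable borel"
  shows "(\<integral>\<^sup>+\<omega>. H \<omega> * g (Y \<omega>) \<partial>M) = (\<integral>\<^sup>+\<omega>. H \<omega> \<partial>M) * (\<integral>\<^sup>+\<omega>. g (Y \<omega>) \<partial>M)"
proof -
  let ?V = "vimage_algebra (space M) Y borel"
  have sub: "sets N \<subseteq> events" "sets ?V \<subseteq> events"
    using indep by (auto simp: indep_sets2_eq)
  have gY: "(\<lambda>\<omega>. g (Y \<omega>)) \<in> borel_measurable ?V"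
    by (intro measurable_compose[OF _ g] measurable_vimage_algebra1) auto
  have rv: "random_variable borel H" "random_variable borel (\<lambda>\<omega>. g (Y \<omega>))"
    by (rule measurable_from_subalg[OF _ H] measurable_from_subalg[OF _ gY],
        use sub N in \<open>simp add: subalgebra_def\<close>)+
  have "sigma_sets (space M) {H -` A \<inter> space M |A. A \<in> sets borel} \<subseteq> sets N"
    unfolding N[symmetric] by (rule sets.sigma_sets_subset) (use measurable_sets[OF H] in auto)
  moreover have "sigma_sets (space ?V) {(\<lambda>\<omega>. g (Y \<omega>)) -` A \<inter> space ?V |A. A \<in> sets borel} \<subseteq> sets ?V"
    by (rule sets.sigma_sets_subset) (use measurable_sets[OF gY] in auto)
  ultimately have "indep_set (sigma_sets (space M) {H -` A \<inter> space M |A. A \<in> sets borel})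
      (sigma_sets (space M) {(\<lambda>\<omega>. g (Y \<omega>)) -` A \<inter> space M |A. A \<in> sets borel})"
    using indep unfolding indep_sets2_eq space_vimage_algebra by blast
  with rv have "indep_var borel H borel (\<lambda>\<omega>. g (Y \<omega>))"
    unfolding indep_var_eq by blast
  \<comment> \<open>\<open>indep_var\<close> is a family over \<open>bool\<close>; with equal target
    spaces it takes the constant form that the product rule for integrals expects.\<close>
  moreover have "case_bool borel borel = (\<lambda>_. borel :: ennreal measure)"
    by (auto split: bool.split)
  ultimately have "indep_vars (\<lambda>_. borel) (case_bool H (\<lambda>\<omega>. g (Y \<omega>))) UNIV"
    by (simp add: indep_var_def)
  from indep_vars_nn_integral[OF _ this] show ?thesis
    by (simp add: UNIV_bool mult.commute)
qed

section \<open>Moments of a single reward and its independence from all others\<close>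

context tree_bandit
begin

lemma reward_measurable [measurable]:
  "l \<in> leaves D \<Longrightarrow> k \<ge> 1 \<Longrightarrow> random_variable borel (X l k)"
  using independent by (auto simp: indep_vars_def)

lemma reward_bounded: 
  assumes "l \<in> leaves D" "k \<ge> 1"
  shows "AE \<omega> in M. X l k \<omega> \<in> {0..1}"
proof -
  have "AE x in distr M borel (X l k). x \<in> {0..1}"
    unfolding identically_distributed[OF assms] by (rule bounded_rewards[OF assms(1)])
  then show ?thesis using assms by (subst (asm) AE_distr_iff) auto
qed

lemma expectation_reward:
  assumes "l \<in> leaves D" "k \<ge> 1"
  shows "expectation (X l k) = leaf_value \<nu> l"
  unfolding leaf_value_def identically_distributed[OF assms, symmetric]
  using assms by (subst integral_distr) auto

lemma leaf_value_unit:
  assumes "l \<in> leaves D"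
  shows "leaf_value \<nu> l \<in> {0..1}"
proof -
  have r: "AE \<omega> in M. X l 1 \<omega> \<in> {0..1}" using reward_bounded[OF assms] by simp
  interpret b: interval_bounded_random_variable M "X l 1" 0 1
    by unfold_locales (use r assms in auto)
  have "expectation (X l 1) \<le> expectation (\<lambda>_. 1)"
    using r by (intro integral_mono_AE b.integrable) auto
  moreover have "0 \<le> expectation (X l 1)"
    using r by (intro integral_nonneg_AE) auto
  ultimately show ?thesis
    using expectation_reward[OF assms, of 1] by (simp add: prob_space)
qed

text \<open>Hoeffding's lemma with its bound moved into the exponent. For negative \<open>s\<close>
  it is applied to the negated reward, which again lies in an interval of length 1; hence
  \<open>pos\<close> leaves the interval general.\<close>

lemma reward_exp_moment:
  assumes "l \<in> leaves D" "k \<ge> 1"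
  shows "(\<integral>\<^sup>+\<omega>. ennreal (exp (s * (X l k \<omega> - leaf_value \<nu> l) - s\<^sup>2 / 8)) \<partial>M) \<le> 1"
proof -
  have pos: "(\<integral>\<^sup>+\<omega>. ennreal (exp (s * (f \<omega> - expectation f) - s\<^sup>2 / 8)) \<partial>M) \<le> 1"
    if "interval_bounded_random_variable M f a b" "b - a = 1" "s > 0" for s f a b
  proof -
    interpret b: interval_bounded_random_variable M f a b by fact
    have "(\<integral>\<^sup>+\<omega>. ennreal (exp (s * (f \<omega> - expectation f) - s\<^sup>2 / 8)) \<partial>M)
      = (\<integral>\<^sup>+\<omega>. ennreal (exp (- (s\<^sup>2 / 8))) * ennreal (exp (s * (f \<omega> - expectation f))) \<partial>M)"
      by (simp add: mult_exp_exp flip: ennreal_mult)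
    also have "\<dots> = ennreal (exp (- (s\<^sup>2 / 8))) * (\<integral>\<^sup>+\<omega>. ennreal (exp (s * (f \<omega> - expectation f))) \<partial>M)"
      by (rule nn_integral_cmult) measurable
    also have "\<dots> \<le> ennreal (exp (- (s\<^sup>2 / 8))) * ennreal (exp (s\<^sup>2 * (b - a)\<^sup>2 / 8))"
      using that by (intro mult_left_mono b.Hoeffdings_lemma_nn_integral) auto
    also have "\<dots> = 1"
      using that by (simp add: exp_minus flip: ennreal_mult)
    finally show ?thesis .
  qed
  consider "s > 0" | "s = 0" | "s < 0" by linarith
  then show ?thesis
  proof cases
    case 1
    have "interval_bounded_random_variable M (X l k) 0 1"
      by unfold_locales (use assms reward_bounded[OF assms] in auto)
    from pos[OF this _ 1] show ?thesis by (simp add: expectation_reward[OF assms])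
  next
    case 2
    then show ?thesis by (simp add: emeasure_space_1)
  next
    case 3
    have "AE \<omega> in M. - X l k \<omega> \<in> {-1..0}"
      by (rule eventually_mono[OF reward_bounded[OF assms]]) auto
    then have "interval_bounded_random_variable M (\<lambda>\<omega>. - X l k \<omega>) (-1) 0"
      by unfold_locales (use assms in auto)
    from pos[OF this, of "- s"] 3 show ?thesis
      by (simp add: expectation_reward[OF assms] algebra_simps)
  qed
qed

lemma reward_independent_of_rest:
  assumes lk: "(l, k) \<in> leaves D \<times> {1..}"
  obtains N where "space N = space M" "U \<in> measurable N S"
    "\<And>l' k'. (l', k') \<in> leaves D \<times> {1..} - {(l, k)} \<Longrightarrow> X l' k' \<in> borel_measurable N"
    "indep_set (sets N) (sets (vimage_algebra (space M) (X l k) borel))"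
proof -
  define L where "L = leaves D \<times> {1::nat..}"
  define P where "P = L - {(l, k)}"
  define XX where "XX = (\<lambda>(l, k). X l k)"
  define R where "R \<omega> = (\<lambda>p\<in>P. XX p \<omega>)" for \<omega>
  define VU where "VU = vimage_algebra (space M) U S"
  define VL where "VL = vimage_algebra (space M) (\<lambda>\<omega>. \<lambda>p\<in>L. XX p \<omega>) (Pi\<^sub>M L (\<lambda>_. borel :: real measure))"
  define VR where "VR = vimage_algebra (space M) R (Pi\<^sub>M P (\<lambda>_. borel :: real measure))"
  define VX where "VX = vimage_algebra (space M) (X l k) (borel :: real measure)"
  define VR1 where "VR1 = vimage_algebra (space M) (\<lambda>\<omega>. \<lambda>p\<in>{(l, k)}. XX p \<omega>)
    (Pi\<^sub>M {(l, k)} (\<lambda>_. borel :: real measure))"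
  have ind: "indep_vars (\<lambda>_. borel) XX L"
    using independent by (simp add: XX_def L_def)
  have UL: "indep_set (sets VU) (sets VL)"
    using randomization_independent unfolding VU_def VL_def XX_def L_def
    by (simp add: case_prod_beta')
  have XX_VL: "XX p \<in> borel_measurable VL" if "p \<in> L" for p
  proof -
    have "(\<lambda>\<omega>. \<lambda>p\<in>L. XX p \<omega>) \<in> measurable VL (Pi\<^sub>M L (\<lambda>_. borel))"
      unfolding VL_def by (rule measurable_vimage_algebra1) (auto simp: space_PiM)
    from measurable_compose[OF this measurable_component_singleton[OF that]] that
    show ?thesis by simp
  qed
  have R_VL: "R \<in> measurable VL (Pi\<^sub>M P (\<lambda>_. borel))"
    unfolding R_def by (intro measurable_restrict XX_VL) (auto simp: P_def)
  have spVL: "space VL = space M" by (simp add: VL_def)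
  have VR_VL: "sets VR \<subseteq> sets VL"
    unfolding VR_def by (rule sets_image_in_sets[OF spVL R_VL])
  have VX_VL: "sets VX \<subseteq> sets VL"
    unfolding VX_def using XX_VL[of "(l, k)"] lk by (intro sets_image_in_sets spVL) (auto simp: XX_def L_def)
  have "indep_var (Pi\<^sub>M P (\<lambda>_. borel)) (\<lambda>\<omega>. \<lambda>p\<in>P. XX p \<omega>)
    (Pi\<^sub>M {(l, k)} (\<lambda>_. borel)) (\<lambda>\<omega>. \<lambda>p\<in>{(l, k)}. XX p \<omega>)"
    by (rule indep_var_restrict[OF ind]) (use lk in \<open>auto simp: P_def L_def\<close>)
  then have "indep_set (sets VR) (sets VR1)"
    unfolding indep_var_eq VR_def VR1_def sets_vimage_algebra R_def by simp
  moreover have "sets VX \<subseteq> sets VR1"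
  proof -
    have "(\<lambda>\<omega>. \<lambda>p\<in>{(l, k)}. XX p \<omega>) \<in> measurable VR1 (Pi\<^sub>M {(l, k)} (\<lambda>_. borel))"
      unfolding VR1_def by (rule measurable_vimage_algebra1) (auto simp: space_PiM)
    from measurable_compose[OF this measurable_component_singleton[of "(l, k)"]]
    have "X l k \<in> borel_measurable VR1" by (simp add: XX_def)
    then show ?thesis unfolding VX_def by (intro sets_image_in_sets) (auto simp: VR1_def)
  qed
  ultimately have RX: "indep_set (sets VR) (sets VX)"
    unfolding indep_sets2_eq by blast
  define G where "G = {a \<inter> b | a b. a \<in> sets VU \<and> b \<in> sets VR}"
  define N where "N = sigma (space M) G"
  have spU: "space VU = space M" "space VR = space M" "space VX = space M"
    by (auto simp: VU_def VR_def VX_def)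
  have G_Pow: "G \<subseteq> Pow (space M)"
    using sets.sets_into_space[of _ VU] spU by (auto simp: G_def)
  then have setsN: "sets N = sigma_sets (space M) G" and spN: "space N = space M"
    by (auto simp: N_def)
  have "Int_stable G"
  proof (rule Int_stableI)
    fix a b assume "a \<in> G" "b \<in> G"
    then obtain a1 a2 b1 b2 where "a = a1 \<inter> a2" "b = b1 \<inter> b2" "a1 \<in> sets VU" "b1 \<in> sets VU"
      "a2 \<in> sets VR" "b2 \<in> sets VR" by (auto simp: G_def)
    then have "a \<inter> b = (a1 \<inter> b1) \<inter> (a2 \<inter> b2)" "a1 \<inter> b1 \<in> sets VU" "a2 \<inter> b2 \<in> sets VR" by auto
    then show "a \<inter> b \<in> G" unfolding G_def by blast
  qed
  moreover have "indep_set G (sets VX)"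
  proof (rule indep_setI)
    show "G \<subseteq> events" "sets VX \<subseteq> events"
      using UL RX by (auto simp: indep_sets2_eq G_def)
    fix g c assume "g \<in> G" and c: "c \<in> sets VX"
    then obtain a b where g: "g = a \<inter> b" and a: "a \<in> sets VU" and b: "b \<in> sets VR"
      by (auto simp: G_def)
    have "prob (g \<inter> c) = prob (a \<inter> (b \<inter> c))" by (simp add: g Int_assoc)
    also have "\<dots> = prob a * prob (b \<inter> c)"
      using a b c VR_VL VX_VL by (intro indep_setD[OF UL]) auto
    also have "\<dots> = prob a * prob b * prob c"
      using indep_setD[OF RX b c] by simp
    also have "prob a * prob b = prob g"
      unfolding g using a b VR_VL by (subst indep_setD[OF UL]) auto
    finally show "prob (g \<inter> c) = prob g * prob c" .
  qed
  moreover have "Int_stable (sets VX)" by (auto simp: Int_stable_def)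
  ultimately have "indep_set (sigma_sets (space M) G) (sigma_sets (space M) (sets VX))"
    by (intro indep_set_sigma_sets)
  then have N_indep: "indep_set (sets N) (sets VX)"
    using sets.sigma_sets_eq[of VX] spU by (simp add: setsN)
  have "sets VU \<subseteq> G"
  proof
    fix a assume a: "a \<in> sets VU"
    then have "a = a \<inter> space M" "a = space M \<inter> a" using sets.sets_into_space[OF a] spU by auto
    moreover have "space M \<in> sets VR" using sets.top[of VR] spU by simp
    ultimately show "a \<in> G" using a unfolding G_def by blast
  qed
  then have VU_N: "sets VU \<subseteq> sets N" unfolding setsN by (auto intro: sigma_sets.Basic)
  have "sets VR \<subseteq> G"
  proof
    fix a assume a: "a \<in> sets VR"
    then have "a = a \<inter> space M" "a = space M \<inter> a" using sets.sets_into_space[OF a] spU by auto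
    moreover have "space M \<in> sets VU" using sets.top[of VU] spU by simp
    ultimately show "a \<in> G" using a unfolding G_def by blast
  qed
  then have VR_N: "sets VR \<subseteq> sets N" unfolding setsN by (auto intro: sigma_sets.Basic)
  have "U \<in> measurable VU S"
    unfolding VU_def using randomization_measurable
    by (intro measurable_vimage_algebra1) (auto simp: measurable_def)
  then have U_N: "U \<in> measurable N S"
    using VU_N spU spN by (intro measurable_from_subalg[of N VU]) (auto simp: subalgebra_def)
  have "R \<in> measurable VR (Pi\<^sub>M P (\<lambda>_. borel))"
    unfolding VR_def R_def by (rule measurable_vimage_algebra1) (auto simp: space_PiM)
  then have R_N: "R \<in> measurable N (Pi\<^sub>M P (\<lambda>_. borel))"
    using VR_N spU spN by (intro measurable_from_subalg[of N VR]) (auto simp: subalgebra_def)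
  have "X l' k' \<in> borel_measurable N" if "(l', k') \<in> leaves D \<times> {1..} - {(l, k)}" for l' k'
  proof -
    have p: "(l', k') \<in> P" using that by (auto simp: P_def L_def)
    from measurable_compose[OF R_N measurable_component_singleton[OF p]] p
    show ?thesis by (simp add: R_def XX_def)
  qed
  with N_indep U_N spN show thesis by (intro that[of N]) (auto simp: VX_def)
qed

end

subsection \<open>Concentration along a run\<close>

locale tree_search = tree_bandit M D \<nu> X S U
  for M :: "'w measure" and D and \<nu> :: "node \<Rightarrow> real measure" and X and S :: "'u measure" and U +
  fixes B :: "node \<Rightarrow> nat \<Rightarrow> real \<Rightarrow> ereal" and I :: "nat \<Rightarrow> 'w \<Rightarrow> node"
  assumes run: "tree_search_run M D B X S U I"
begin

lemma greedy:
  "n \<ge> 1 \<Longrightarrow> \<omega> \<in> space M \<Longrightarrow>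
    greedy_leaf D (\<lambda>j. B j (visits I j (n - 1) \<omega>) (empirical_mean X I j (n - 1) \<omega>)) (I n \<omega>)"
  using run by (simp add: tree_search_run_def)

lemma run_leaf: "n \<ge> 1 \<Longrightarrow> \<omega> \<in> space M \<Longrightarrow> I n \<omega> \<in> leaves D"
  using greedy by (auto simp: greedy_leaf_def)

lemma visits_measurable:
  assumes "\<And>s. s \<in> {1..n} \<Longrightarrow> I s \<in> measurable R (count_space UNIV)"
  shows "visits I i n \<in> measurable R (count_space UNIV)"
  using assms
proof (induction n)
  case 0
  have "visits I i 0 = (\<lambda>_. 0)" by (rule ext) simp
  then show ?case by simp
next
  case (Suc n)
  have v: "visits I i n \<in> measurable R (count_space UNIV)" using Suc by auto
  have "(\<lambda>\<omega>. visits I i n \<omega> + of_bool (prefix i (I (Suc n) \<omega>))) \<in> measurable R (count_space UNIV)"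
  proof (rule measurable_compose_countable[where g = "I (Suc n)"
        and f = "\<lambda>l \<omega>. visits I i n \<omega> + of_bool (prefix i l)"])
    show "(\<lambda>\<omega>. visits I i n \<omega> + of_bool (prefix i l)) \<in> measurable R (count_space UNIV)" for l
      by (rule measurable_compose[OF v]) simp
    show "I (Suc n) \<in> measurable R (count_space UNIV)" using Suc by auto
  qed
  then show ?case by (simp add: visits_Suc[abs_def])
qed

definition past_in :: "(node \<times> nat) set \<Rightarrow> nat \<Rightarrow> 'w set" where
  "past_in J t = {\<omega> \<in> space M. \<forall>s\<in>{1..<t}. (I s \<omega>, visits I (I s \<omega>) s \<omega>) \<in> J}"

text \<open>
  On the event \<open>past_in J t\<close> the rounds before \<open>t\<close> used only rewards with index in \<open>J\<close>; hence a
  sigma-algebra that knows \<open>U\<close> and these rewards also knows, on this event, the history of the run.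
\<close>

lemma
  assumes N: "space N = space M" "U \<in> measurable N S"
    and XN: "\<And>l k. (l, k) \<in> J \<Longrightarrow> X l k \<in> borel_measurable N"
  shows past_in_sets: "past_in J t \<in> sets N"
    and past_in_history: "\<And>s. s \<in> {1..<t} \<Longrightarrow>
      I s \<in> measurable (restrict_space N (past_in J t)) (count_space UNIV)"
      "\<And>s. s \<in> {1..<t} \<Longrightarrow> reward X I s \<in> borel_measurable (restrict_space N (past_in J t))"
    and past_in_next: "t \<ge> 1 \<Longrightarrow> I t \<in> measurable (restrict_space N (past_in J t)) (count_space UNIV)"
proof -
  have nxt: "I t \<in> measurable R (count_space UNIV)"
    if t: "t \<ge> 1" and R: "R = restrict_space N E"
      and I: "\<And>s. s \<in> {1..<t} \<Longrightarrow> I s \<in> measurable R (count_space UNIV)"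
      and r: "\<And>s. s \<in> {1..<t} \<Longrightarrow> reward X I s \<in> borel_measurable R" for t R E
  proof -
    let ?h = "\<lambda>\<omega>. (U \<omega>, \<lambda>s\<in>{1..<t}. (I s \<omega>, reward X I s \<omega>))"
    let ?H = "S \<Otimes>\<^sub>M Pi\<^sub>M {1..<t} (\<lambda>_. count_space UNIV \<Otimes>\<^sub>M borel)"
    have "?h \<in> measurable R ?H"
    proof (rule measurable_Pair)
      show "U \<in> measurable R S" unfolding R by (rule measurable_restrict_space1[OF N(2)])
      show "(\<lambda>\<omega>. \<lambda>s\<in>{1..<t}. (I s \<omega>, reward X I s \<omega>)) \<in> measurable R (Pi\<^sub>M {1..<t} (\<lambda>_. count_space UNIV \<Otimes>\<^sub>M borel))"
        by (intro measurable_restrict measurable_Pair I r)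
    qed
    then have "(\<lambda>\<omega>. \<omega>) \<in> measurable R (vimage_algebra (space M) ?h ?H)"
      by (intro measurable_vimage_algebra2) (auto simp: R space_restrict_space N)
    moreover have "I t \<in> measurable (vimage_algebra (space M) ?h ?H) (count_space UNIV)"
      using run t by (simp add: tree_search_run_def non_anticipating_def)
    ultimately show ?thesis by (rule measurable_compose)
  qed
  have main: "past_in J t \<in> sets N \<and>
    (\<forall>s\<in>{1..<t}. I s \<in> measurable (restrict_space N (past_in J t)) (count_space UNIV) \<and>
      reward X I s \<in> borel_measurable (restrict_space N (past_in J t)))"
  proof (induction t)
    case 0
    have "past_in J 0 = space N" by (simp add: past_in_def N)
    then show ?case by simp
  next
    case (Suc t)
    show ?case
    proof (cases "t = 0")
      case True
      then have "past_in J (Suc t) = space N" by (simp add: past_in_def N)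
      then show ?thesis using True by simp
    next
      case False
      then have t: "t \<ge> 1" by simp
      define R where "R = restrict_space N (past_in J t)"
      have IR: "I s \<in> measurable R (count_space UNIV)"
        and rR: "reward X I s \<in> borel_measurable R" if "s \<in> {1..<t}" for s
        using Suc that by (auto simp: R_def)
      have sets_t: "past_in J t \<in> sets N" using Suc by simp
      have It: "I t \<in> measurable R (count_space UNIV)"
        by (rule nxt[OF t R_def IR rR])
      have IR': "I s \<in> measurable R (count_space UNIV)" if "s \<in> {1..t}" for s
        using that It IR by (cases "s = t") auto
      define P where "P \<omega> = (I t \<omega>, visits I (I t \<omega>) t \<omega>)" for \<omega>
      have "(\<lambda>\<omega>. (l, visits I l t \<omega>)) \<in> measurable R (count_space UNIV)" for l
        by (rule measurable_compose[OF visits_measurable]) (use IR' in auto)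
      from measurable_compose_countable[OF this It]
      have P: "P \<in> measurable R (count_space UNIV)" unfolding P_def .
      have past_in_Suc: "past_in J (Suc t) = {\<omega> \<in> space R. P \<omega> \<in> J}"
        using t sets.sets_into_space[OF sets_t] N
        by (auto simp: R_def space_restrict_space past_in_def P_def less_Suc_eq)
      have "past_in J (Suc t) \<in> sets R"
        unfolding past_in_Suc using measurable_sets[OF P, of J] by (simp add: vimage_def Int_def conj_commute)
      then have sets_Suc: "past_in J (Suc t) \<in> sets N"
        unfolding R_def using sets_t by (subst (asm) sets_restrict_space_iff) auto
      have sub: "past_in J (Suc t) \<subseteq> past_in J t" by (auto simp: past_in_def)
      define R' where "R' = restrict_space N (past_in J (Suc t))"
      have R': "R' = restrict_space R (past_in J (Suc t))"
        unfolding R_def R'_def using sub sets_t sets_Suc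
        by (subst restrict_restrict_space) (auto simp: Int_absorb1)
      have PJ: "P \<in> measurable R' (count_space J)"
      proof (rule measurable_count_space_extend[OF subset_UNIV])
        show "P \<in> space R' \<rightarrow> J" unfolding R'_def using past_in_Suc by (auto simp: space_restrict_space)
        show "P \<in> measurable R' (count_space UNIV)"
          unfolding R' by (rule measurable_restrict_space1[OF P])
      qed
      have "(\<lambda>\<omega>. case P \<omega> of (l, k) \<Rightarrow> X l k \<omega>) \<in> borel_measurable R'"
      proof (rule measurable_compose_countable'[where f = "\<lambda>p \<omega>. case p of (l, k) \<Rightarrow> X l k \<omega>", OF _ PJ])
        show "(\<lambda>\<omega>. case p of (l, k) \<Rightarrow> X l k \<omega>) \<in> borel_measurable R'" if "p \<in> J" for p
          using that XN unfolding R'_def by (auto intro!: measurable_restrict_space1 split: prod.split)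
      qed auto
      then have rt: "reward X I t \<in> borel_measurable R'"
        by (simp add: P_def reward_def[abs_def])
      have "I s \<in> measurable R' (count_space UNIV) \<and> reward X I s \<in> borel_measurable R'"
        if "s \<in> {1..<Suc t}" for s
      proof
        show "I s \<in> measurable R' (count_space UNIV)"
          unfolding R' using that IR' by (intro measurable_restrict_space1) auto
        show "reward X I s \<in> borel_measurable R'"
        proof (cases "s = t")
          case False
          then show ?thesis unfolding R' using that rR by (intro measurable_restrict_space1) auto
        qed (use rt in simp)
      qed
      then show ?thesis using sets_Suc by (simp add: R'_def)
    qed
  qed
  show "past_in J t \<in> sets N" using main by simp
  show I: "I s \<in> measurable (restrict_space N (past_in J t)) (count_space UNIV)" if "s \<in> {1..<t}" for s
    using main that by simp
  show r: "reward X I s \<in> borel_measurable (restrict_space N (past_in J t))" if "s \<in> {1..<t}" for s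
    using main that by simp
  show "I t \<in> measurable (restrict_space N (past_in J t)) (count_space UNIV)" if "t \<ge> 1"
    by (rule nxt[OF that refl I r])
qed

lemma run_visits_pos: "n \<ge> 1 \<Longrightarrow> visits I (I n \<omega>) n \<omega> \<ge> 1"
  using visits_Suc[of I "I n \<omega>" "n - 1" \<omega>] by (cases n) auto

lemma
  assumes "n \<ge> 1"
  shows run_measurable: "I n \<in> measurable M (count_space UNIV)"
    and run_reward_measurable: "reward X I n \<in> borel_measurable M"
proof -
  let ?J = "leaves D \<times> {1..}"
  have *: "restrict_space M (past_in ?J t) = restrict_space M (space M)" for t
    using run_leaf run_visits_pos by (intro arg_cong[where f = "restrict_space M"]) (auto simp: past_in_def)
  have eq_real: "measurable (restrict_space M (past_in ?J t)) T = measurable M T" for t and T :: "real measure"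
    unfolding * by (rule measurable_cong_sets) (auto simp: sets_restrict_space)
  have eq_node: "measurable (restrict_space M (past_in ?J t)) T = measurable M T" for t and T :: "node measure"
    unfolding * by (rule measurable_cong_sets) (auto simp: sets_restrict_space)
  show "I n \<in> measurable M (count_space UNIV)"
    using past_in_next[of M ?J n] assms randomization_measurable unfolding eq_node by auto
  show "reward X I n \<in> borel_measurable M"
    using past_in_history(2)[of M ?J n "Suc n"] assms randomization_measurable unfolding eq_real by auto
qed

definition counted :: "node \<Rightarrow> nat \<Rightarrow> nat \<Rightarrow> 'w \<Rightarrow> bool" where
  "counted i m t \<omega> \<longleftrightarrow> prefix i (I t \<omega>) \<and> visits I i (t - 1) \<omega> < m"

definition exp_process :: "real \<Rightarrow> node \<Rightarrow> nat \<Rightarrow> nat \<Rightarrow> 'w \<Rightarrow> real" where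
  "exp_process s i m n \<omega> = (\<Prod>t\<in>{1..n}. if counted i m t \<omega>
     then exp (s * (reward X I t \<omega> - leaf_value \<nu> (I t \<omega>)) - s\<^sup>2 / 8) else 1)"

lemma exp_process_pos: "exp_process s i m n \<omega> > 0"
  unfolding exp_process_def by (intro prod_pos) auto

lemma counted_measurable:
  assumes "t \<ge> 1" "\<And>s. s \<in> {1..t} \<Longrightarrow> I s \<in> measurable R (count_space UNIV)"
  shows "Measurable.pred R (counted i m t)"
proof -
  have [measurable]: "visits I i (t - 1) \<in> measurable R (count_space UNIV)"
    using assms by (intro visits_measurable) auto
  have [measurable]: "I t \<in> measurable R (count_space UNIV)" using assms by auto
  show ?thesis unfolding counted_def[abs_def] by measurable
qed

lemma exp_process_measurable:
  assumes I: "\<And>s. s \<in> {1..n} \<Longrightarrow> I s \<in> measurable R (count_space UNIV)"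
    and r: "\<And>s. s \<in> {1..n} \<Longrightarrow> reward X I s \<in> borel_measurable R"
  shows "exp_process s i m n \<in> borel_measurable R"
  unfolding exp_process_def[abs_def]
proof (rule borel_measurable_prod)
  fix t assume t: "t \<in> {1..n}"
  have [measurable]: "Measurable.pred R (counted i m t)"
    using t I by (intro counted_measurable) auto
  have [measurable]: "reward X I t \<in> borel_measurable R" using r t by auto
  have [measurable]: "(\<lambda>\<omega>. leaf_value \<nu> (I t \<omega>)) \<in> borel_measurable R"
    by (rule measurable_compose[OF I[OF t]]) simp
  show "(\<lambda>\<omega>. if counted i m t \<omega>
     then exp (s * (reward X I t \<omega> - leaf_value \<nu> (I t \<omega>)) - s\<^sup>2 / 8) else 1) \<in> borel_measurable R"
    by measurable
qed

text \<open>
  On the event \<open>A\<close> that round \<open>n + 1\<close> makes the \<open>k\<close>-th visit of the leaf \<open>l\<close>, the past involves only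
  the other rewards, so that the fresh reward \<open>X l k\<close> is independent of it.
\<close>

lemma exp_process_step:
  fixes s :: real and n :: nat
  assumes lk: "l \<in> leaves D" "k \<ge> 1"
  defines "A \<equiv> {\<omega>. I (Suc n) \<omega> = l \<and> visits I l n \<omega> = k - 1}"
  shows "(\<integral>\<^sup>+\<omega>. ennreal (exp_process s i m (Suc n) \<omega>) * indicator A \<omega> \<partial>M)
    \<le> (\<integral>\<^sup>+\<omega>. ennreal (exp_process s i m n \<omega>) * indicator A \<omega> \<partial>M)"
proof -
  obtain N where N: "space N = space M" "U \<in> measurable N S"
    "\<And>l' k'. (l', k') \<in> leaves D \<times> {1..} - {(l, k)} \<Longrightarrow> X l' k' \<in> borel_measurable N"
    "indep_set (sets N) (sets (vimage_algebra (space M) (X l k) borel))"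
    using reward_independent_of_rest[of l k] lk by auto
  define J where "J = leaves D \<times> {1..} - {(l, k)}"
  define E where "E = past_in J (Suc n)"
  define R where "R = restrict_space N E"
  have E: "E \<in> sets N" unfolding E_def by (rule past_in_sets[OF N(1,2)]) (use N in \<open>auto simp: J_def\<close>)
  have I: "I t \<in> measurable R (count_space UNIV)" if "t \<in> {1..Suc n}" for t
    unfolding R_def E_def using that past_in_history(1)[OF N(1,2), of J t "Suc n"] past_in_next[OF N(1,2), of J "Suc n"] N(3)
    by (cases "t = Suc n") (auto simp: J_def)
  have r: "reward X I t \<in> borel_measurable R" if "t \<in> {1..n}" for t
    unfolding R_def E_def using that past_in_history(2)[OF N(1,2), of J t "Suc n"] N(3)
    by (auto simp: J_def)
  have AE: "\<omega> \<in> E" if "\<omega> \<in> A" "\<omega> \<in> space M" for \<omega>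
  proof -
    have "(I t \<omega>, visits I (I t \<omega>) t \<omega>) \<in> J" if t: "t \<in> {1..<Suc n}" for t
    proof -
      have "visits I l t \<omega> \<le> k - 1" using visits_mono[of t n I l \<omega>] t \<open>\<omega> \<in> A\<close> by (auto simp: A_def)
      then show ?thesis
        using t \<open>\<omega> \<in> space M\<close> run_leaf run_visits_pos lk(2) by (fastforce simp: J_def)
    qed
    then show ?thesis using that by (simp add: E_def past_in_def)
  qed
  define H where "H b \<omega> = ennreal (exp_process s i m n \<omega>)
    * indicator {\<omega> \<in> A. counted i m (Suc n) \<omega> = b} \<omega> * indicator E \<omega>" for b \<omega>
  have H: "H b \<in> borel_measurable N" for b
  proof -
    have [measurable]: "exp_process s i m n \<in> borel_measurable R"
      using I r by (intro exp_process_measurable) auto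
    have [measurable]: "Measurable.pred R (counted i m (Suc n))"
      using I by (intro counted_measurable) auto
    have [measurable]: "visits I l n \<in> measurable R (count_space UNIV)"
      using I by (intro visits_measurable) auto
    have [measurable]: "I (Suc n) \<in> measurable R (count_space UNIV)" using I by auto
    have [measurable]: "Measurable.pred R (\<lambda>\<omega>. \<omega> \<in> {\<omega> \<in> A. counted i m (Suc n) \<omega> = b})"
      unfolding A_def mem_Collect_eq by measurable
    have "(\<lambda>\<omega>. ennreal (exp_process s i m n \<omega>) * indicator {\<omega> \<in> A. counted i m (Suc n) \<omega> = b} \<omega>)
        \<in> borel_measurable R"
      by measurable
    then show ?thesis
      unfolding R_def H_def[abs_def] using E by (subst (asm) borel_measurable_restrict_space_iff_ennreal) auto
  qed
  have sub: "sets N \<subseteq> events" using N(4) by (auto simp: indep_sets2_eq)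
  have HM [measurable]: "H b \<in> borel_measurable M" for b
    by (rule measurable_from_subalg[OF _ H]) (use sub N(1) in \<open>simp add: subalgebra_def\<close>)
  define g where "g x = ennreal (exp (s * (x - leaf_value \<nu> l) - s\<^sup>2 / 8))" for x
  have g [measurable]: "g \<in> borel_measurable borel" unfolding g_def[abs_def] by measurable
  have [measurable]: "X l k \<in> borel_measurable M" using lk by simp
  have new: "ennreal (exp_process s i m (Suc n) \<omega>) * indicator A \<omega> = H False \<omega> + H True \<omega> * g (X l k \<omega>)"
    if "\<omega> \<in> space M" for \<omega>
  proof (cases "\<omega> \<in> A")
    case True
    then have "visits I l (Suc n) \<omega> = k" using lk(2) by (simp add: A_def visits_Suc)
    then have "reward X I (Suc n) \<omega> = X l k \<omega>" using True by (simp add: reward_def A_def)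
    moreover have "I (Suc n) \<omega> = l" using True by (simp add: A_def)
    ultimately show ?thesis
      using AE[OF True that] True exp_process_pos[of s i m n \<omega>]
      by (cases "counted i m (Suc n) \<omega>") (auto simp: H_def g_def exp_process_def ennreal_mult less_imp_le)
  qed (simp add: H_def)
  have old: "ennreal (exp_process s i m n \<omega>) * indicator A \<omega> = H False \<omega> + H True \<omega>"
    if "\<omega> \<in> space M" for \<omega>
    using AE[OF _ that] by (cases "\<omega> \<in> A"; cases "counted i m (Suc n) \<omega>") (auto simp: H_def)
  have "(\<integral>\<^sup>+\<omega>. ennreal (exp_process s i m (Suc n) \<omega>) * indicator A \<omega> \<partial>M)
    = (\<integral>\<^sup>+\<omega>. H False \<omega> + H True \<omega> * g (X l k \<omega>) \<partial>M)"
    by (rule nn_integral_cong) (rule new)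
  also have "\<dots> = (\<integral>\<^sup>+\<omega>. H False \<omega> \<partial>M) + (\<integral>\<^sup>+\<omega>. H True \<omega> * g (X l k \<omega>) \<partial>M)"
    by (rule nn_integral_add) measurable
  also have "(\<integral>\<^sup>+\<omega>. H True \<omega> * g (X l k \<omega>) \<partial>M) = (\<integral>\<^sup>+\<omega>. H True \<omega> \<partial>M) * (\<integral>\<^sup>+\<omega>. g (X l k \<omega>) \<partial>M)"
    by (rule indep_set_nn_integral_mult[OF N(1) N(4) H g])
  also have "\<dots> \<le> (\<integral>\<^sup>+\<omega>. H True \<omega> \<partial>M) * 1"
    unfolding g_def by (intro mult_left_mono reward_exp_moment lk) auto
  also have "(\<integral>\<^sup>+\<omega>. H False \<omega> \<partial>M) + (\<integral>\<^sup>+\<omega>. H True \<omega> \<partial>M) * 1 = (\<integral>\<^sup>+\<omega>. H False \<omega> + H True \<omega> \<partial>M)"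
    by (subst nn_integral_add) auto
  also have "\<dots> = (\<integral>\<^sup>+\<omega>. ennreal (exp_process s i m n \<omega>) * indicator A \<omega> \<partial>M)"
    by (rule nn_integral_cong) (rule old[symmetric])
  finally show ?thesis by (simp add: add_left_mono)
qed

lemma exp_process_le_1: "(\<integral>\<^sup>+\<omega>. ennreal (exp_process s i m n \<omega>) \<partial>M) \<le> 1"
proof (induction n)
  case 0
  then show ?case by (simp add: exp_process_def emeasure_space_1)
next
  case (Suc n)
  define A where "A l k = {\<omega>. I (Suc n) \<omega> = l \<and> visits I l n \<omega> = k - 1}" for l k
  define Q where "Q = leaves D \<times> {1..Suc n}"
  have Q: "finite Q" by (simp add: Q_def)
  have part: "(\<Sum>(l, k)\<in>Q. indicator (A l k) \<omega>) = (1::ennreal)" if "\<omega> \<in> space M" for \<omega>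
  proof -
    let ?p = "(I (Suc n) \<omega>, Suc (visits I (I (Suc n) \<omega>) n \<omega>))"
    have "(\<Sum>(l, k)\<in>Q. indicator (A l k) \<omega>) = (\<Sum>p\<in>Q. if p = ?p then 1 else (0::ennreal))"
      by (intro sum.cong) (auto simp: A_def Q_def indicator_def)
    also have "\<dots> = 1"
      using run_leaf[of "Suc n" \<omega>] that visits_le[of I _ n \<omega>] Q by (auto simp: Q_def)
    finally show ?thesis .
  qed
  have meas [measurable]: "exp_process s i m n \<in> borel_measurable M" for n
    by (intro exp_process_measurable run_measurable run_reward_measurable) auto
  have [measurable]: "I (Suc n) \<in> measurable M (count_space UNIV)" by (intro run_measurable) auto
  have [measurable]: "visits I l n \<in> measurable M (count_space UNIV)" for l
    by (intro visits_measurable run_measurable) auto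
  have A [measurable]: "Measurable.pred M (\<lambda>\<omega>. \<omega> \<in> A l k)" for l k
    unfolding A_def mem_Collect_eq by measurable
  have decomp: "(\<integral>\<^sup>+\<omega>. ennreal (exp_process s i m n' \<omega>) \<partial>M)
    = (\<Sum>(l, k)\<in>Q. \<integral>\<^sup>+\<omega>. ennreal (exp_process s i m n' \<omega>) * indicator (A l k) \<omega> \<partial>M)" for n'
  proof -
    have "(\<integral>\<^sup>+\<omega>. ennreal (exp_process s i m n' \<omega>) \<partial>M)
      = (\<integral>\<^sup>+\<omega>. (\<Sum>p\<in>Q. ennreal (exp_process s i m n' \<omega>) * indicator (A (fst p) (snd p)) \<omega>) \<partial>M)"
      using part by (intro nn_integral_cong) (simp add: case_prod_beta' flip: sum_distrib_left)
    also have "\<dots> = (\<Sum>p\<in>Q. \<integral>\<^sup>+\<omega>. ennreal (exp_process s i m n' \<omega>) * indicator (A (fst p) (snd p)) \<omega> \<partial>M)"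
      by (rule nn_integral_sum) measurable
    finally show ?thesis by (simp add: case_prod_beta')
  qed
  have "(\<integral>\<^sup>+\<omega>. ennreal (exp_process s i m (Suc n) \<omega>) \<partial>M) \<le> (\<integral>\<^sup>+\<omega>. ennreal (exp_process s i m n \<omega>) \<partial>M)"
    unfolding decomp unfolding A_def Q_def
    by (intro sum_mono) (clarify, rule exp_process_step, auto)
  with Suc show ?case by simp
qed

definition deviation :: "node \<Rightarrow> nat \<Rightarrow> 'w \<Rightarrow> real" where
  "deviation i n \<omega> = (\<Sum>t\<in>rounds I i n \<omega>. reward X I t \<omega> - leaf_value \<nu> (I t \<omega>))"

lemma exp_process_stopped:
  assumes "visits I i n \<omega> = m" "n \<le> n'"
  shows "exp_process s i m n' \<omega> = exp (s * deviation i n \<omega> - real m * s\<^sup>2 / 8)"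
proof -
  have "t \<in> rounds I i n \<omega>" if "t \<in> {1..n'}" "counted i m t \<omega>" for t
  proof (rule ccontr)
    assume "t \<notin> rounds I i n \<omega>"
    then have "n \<le> t - 1" using that by (auto simp: rounds_def counted_def)
    from visits_mono[OF this, of I i \<omega>] show False using assms that by (simp add: counted_def)
  qed
  moreover have "t \<in> {1..n'} \<and> counted i m t \<omega>" if t: "t \<in> rounds I i n \<omega>" for t
  proof -
    have "visits I i t \<omega> = visits I i (t - 1) \<omega> + 1"
      using visits_Suc[of I i "t - 1" \<omega>] t by (auto simp: rounds_def)
    moreover have "visits I i t \<omega> \<le> m" using visits_mono[of t n I i \<omega>] t assms by (auto simp: rounds_def)
    ultimately show ?thesis using t assms by (auto simp: rounds_def counted_def)
  qed
  ultimately have set: "{t \<in> {1..n'}. counted i m t \<omega>} = rounds I i n \<omega>" by blast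
  have "exp_process s i m n' \<omega> = (\<Prod>t\<in>rounds I i n \<omega>. exp (s * (reward X I t \<omega> - leaf_value \<nu> (I t \<omega>)) - s\<^sup>2 / 8))"
    unfolding exp_process_def set[symmetric] by (rule prod.inter_filter[symmetric]) simp
  also have "\<dots> = exp (\<Sum>t\<in>rounds I i n \<omega>. s * (reward X I t \<omega> - leaf_value \<nu> (I t \<omega>)) - s\<^sup>2 / 8)"
    by (simp add: exp_sum)
  also have "(\<Sum>t\<in>rounds I i n \<omega>. s * (reward X I t \<omega> - leaf_value \<nu> (I t \<omega>)) - s\<^sup>2 / 8)
    = s * deviation i n \<omega> - real m * s\<^sup>2 / 8"
    by (simp add: deviation_def sum_subtractf assms flip: sum_distrib_left)
  finally show ?thesis .
qed

lemma deviation_measurable [measurable]: "deviation i n \<in> borel_measurable M"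
proof -
  have "deviation i n = (\<lambda>\<omega>. \<Sum>t\<in>{1..n}. if prefix i (I t \<omega>) then reward X I t \<omega> - leaf_value \<nu> (I t \<omega>) else 0)"
    unfolding deviation_def[abs_def] rounds_def by (intro ext sum.inter_filter) simp
  moreover have "(\<lambda>\<omega>. if prefix i (I t \<omega>) then reward X I t \<omega> - leaf_value \<nu> (I t \<omega>) else 0) \<in> borel_measurable M"
    if "t \<in> {1..n}" for t
  proof -
    have [measurable]: "I t \<in> measurable M (count_space UNIV)" "reward X I t \<in> borel_measurable M"
      using that run_measurable run_reward_measurable by auto
    have [measurable]: "(\<lambda>\<omega>. leaf_value \<nu> (I t \<omega>)) \<in> borel_measurable M"
      by (rule measurable_compose[of "I t" M "count_space UNIV"]) auto
    show ?thesis by measurable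
  qed
  ultimately show ?thesis by simp
qed

lemma run_visits_measurable [measurable]: "visits I i n \<in> measurable M (count_space UNIV)"
  by (intro visits_measurable run_measurable) auto

text \<open>
  Azuma's inequality, uniformly over all times at which the node \<open>i\<close> has been visited \<open>m\<close> times:
  since \<open>exp_process\<close> is frozen after the \<open>m\<close>-th visit, Markov's inequality at the horizon \<open>T\<close>
  covers all earlier times. The choice \<open>s = \<plusminus> 4 c / m\<close> is optimal.
\<close>

lemma deviation_bound:
  fixes i :: node
  assumes m: "m \<ge> 1" and c: "c \<ge> 0" and sg: "\<sigma> \<in> {1, -1 :: real}"
  defines "bad \<equiv> {\<omega> \<in> space M. \<exists>n. visits I i n \<omega> = m \<and> \<sigma> * deviation i n \<omega> > c}"
  shows "bad \<in> events" and "prob bad \<le> exp (- 2 * c\<^sup>2 / real m)"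
proof -
  define F where "F T = {\<omega> \<in> space M. \<exists>n\<le>T. visits I i n \<omega> = m \<and> \<sigma> * deviation i n \<omega> > c}" for T
  have F: "F T \<in> events" for T
  proof -
    have "{\<omega> \<in> space M. visits I i n \<omega> = m \<and> \<sigma> * deviation i n \<omega> > c} \<in> events" for n
      by measurable
    moreover have "F T = (\<Union>n\<in>{..T}. {\<omega> \<in> space M. visits I i n \<omega> = m \<and> \<sigma> * deviation i n \<omega> > c})"
      by (auto simp: F_def)
    ultimately show ?thesis by auto
  qed
  have bad: "bad = (\<Union>T. F T)" by (auto simp: bad_def F_def)
  show "bad \<in> events" unfolding bad using F by auto
  have "prob (F T) \<le> exp (- 2 * c\<^sup>2 / real m)" for T
  proof -
    define s where "s = \<sigma> * 4 * c / real m"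
    define a where "a = exp (2 * c\<^sup>2 / real m)"
    have [measurable]: "exp_process s i m T \<in> borel_measurable M"
      by (intro exp_process_measurable run_measurable run_reward_measurable) auto
    have "a \<le> exp_process s i m T \<omega>" if "\<omega> \<in> F T" for \<omega>
    proof -
      obtain n where n: "n \<le> T" "visits I i n \<omega> = m" "\<sigma> * deviation i n \<omega> > c"
        using \<open>\<omega> \<in> F T\<close> by (auto simp: F_def)
      have "2 * c\<^sup>2 / real m = 4 * c / real m * c - real m * s\<^sup>2 / 8"
        using m sg by (auto simp: s_def power2_eq_square field_simps)
      also have "\<dots> \<le> 4 * c / real m * (\<sigma> * deviation i n \<omega>) - real m * s\<^sup>2 / 8"
        using n c by (intro diff_right_mono mult_left_mono) auto
      also have "\<dots> = s * deviation i n \<omega> - real m * s\<^sup>2 / 8" by (simp add: s_def)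
      finally show ?thesis by (simp add: a_def exp_process_stopped[OF n(2,1)])
    qed
    moreover have "1 \<le> ennreal (1 / a) * ennreal y" if "a \<le> y" for y
    proof -
      have "a > 0" by (simp add: a_def)
      then have "ennreal 1 \<le> ennreal (1 / a * y)" using that by (intro ennreal_leI) (simp add: field_simps)
      also have "\<dots> = ennreal (1 / a) * ennreal y"
        using \<open>a > 0\<close> that by (intro ennreal_mult) auto
      finally show ?thesis by (simp only: ennreal_1)
    qed
    ultimately have "F T \<subseteq> {\<omega> \<in> space M. 1 \<le> ennreal (1 / a) * ennreal (exp_process s i m T \<omega>)}"
      unfolding F_def by blast
    then have "emeasure M (F T) \<le> emeasure M {\<omega> \<in> space M. 1 \<le> ennreal (1 / a) * ennreal (exp_process s i m T \<omega>)}"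
      by (intro emeasure_mono) measurable
    also have "\<dots> \<le> ennreal (1 / a) * (\<integral>\<^sup>+\<omega>. ennreal (exp_process s i m T \<omega>) * indicator (space M) \<omega> \<partial>M)"
      by (rule nn_integral_Markov_inequality) measurable
    also have "\<dots> = ennreal (1 / a) * (\<integral>\<^sup>+\<omega>. ennreal (exp_process s i m T \<omega>) \<partial>M)"
      by (intro arg_cong[where f = "(*) (ennreal (1 / a))"] nn_integral_cong) auto
    also have "\<dots> \<le> ennreal (1 / a) * 1"
      by (intro mult_left_mono exp_process_le_1) auto
    finally have "emeasure M (F T) \<le> ennreal (exp (- 2 * c\<^sup>2 / real m))"
      by (simp add: a_def exp_minus inverse_eq_divide)
    then show ?thesis by (simp add: emeasure_eq_measure)
  qed
  moreover have "(\<lambda>T. prob (F T)) \<longlonglongrightarrow> prob (\<Union>T. F T)"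
    by (rule finite_Lim_measure_incseq) (use F in \<open>auto simp: incseq_def F_def intro: order_trans\<close>)
  ultimately show "prob bad \<le> exp (- 2 * c\<^sup>2 / real m)"
    unfolding bad by (intro LIMSEQ_le_const2) auto
qed


subsection \<open>The regret bound\<close>

lemma pseudo_regret_eq:
  assumes "\<omega> \<in> space M"
  shows "pseudo_regret D \<nu> I n \<omega> = (\<Sum>t\<in>rounds I [] n \<omega>. node_value D \<nu> [] - leaf_value \<nu> (I t \<omega>))"
proof -
  have "(\<Sum>t=1..n. node_value D \<nu> (I t \<omega>)) = (\<Sum>t=1..n. leaf_value \<nu> (I t \<omega>))"
    using assms by (intro sum.cong node_value_leaf run_leaf) auto
  then show ?thesis by (simp add: pseudo_regret_def sum_subtractf rounds_root)
qed

lemma pseudo_regret_measurable [measurable]: "pseudo_regret D \<nu> I n \<in> borel_measurable M"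
proof -
  have [measurable]: "(\<lambda>\<omega>. node_value D \<nu> (I t \<omega>)) \<in> borel_measurable M" if "t \<in> {1..n}" for t
    using that by (intro measurable_compose[OF run_measurable]) auto
  show ?thesis unfolding pseudo_regret_def[abs_def] by measurable
qed

lemma deviation_union_bound:
  assumes \<beta>: "0 < \<beta>" "\<beta> \<le> 1"
  obtains bad where "bad \<in> events" "prob bad \<le> \<beta>"
    "\<And>\<omega> i n. \<omega> \<in> space M - bad \<Longrightarrow> length i \<le> D \<Longrightarrow>
      \<bar>deviation i n \<omega>\<bar> \<le> conf D \<beta> (visits I i n \<omega>)"
proof
  define V where "V = {i :: node. length i \<le> D}"
  define bad1 where "bad1 i m \<sigma> = {\<omega> \<in> space M. \<exists>n. visits I i n \<omega> = Suc m
      \<and> \<sigma> * deviation i n \<omega> > conf D \<beta> (Suc m)}" for i m and \<sigma> :: real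
  define bad2 where "bad2 i m = bad1 i m 1 \<union> bad1 i m (-1)" for i m
  define bad where "bad = (\<Union>i\<in>V. \<Union>m. bad2 i m)"
  have bad1: "bad1 i m \<sigma> \<in> events" "prob (bad1 i m \<sigma>) \<le> beta_seq D \<beta> (Suc m)" if "\<sigma> \<in> {1, -1}" for i m \<sigma>
  proof -
    show "bad1 i m \<sigma> \<in> events"
      unfolding bad1_def using that conf_nonneg[OF \<beta>] by (intro deviation_bound) auto
    have "prob (bad1 i m \<sigma>) \<le> exp (- 2 * (conf D \<beta> (Suc m))\<^sup>2 / real (Suc m))"
      unfolding bad1_def using that conf_nonneg[OF \<beta>] by (intro deviation_bound) auto
    also have "\<dots> = exp (- ln (inverse (beta_seq D \<beta> (Suc m))))"
      by (simp add: conf_sq[OF \<beta>])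
    also have "\<dots> = beta_seq D \<beta> (Suc m)"
      using beta_seq_pos[OF \<beta>(1), of "Suc m" D] by (simp add: ln_inverse)
    finally show "prob (bad1 i m \<sigma>) \<le> beta_seq D \<beta> (Suc m)" .
  qed
  have bad2: "bad2 i m \<in> events" "prob (bad2 i m) \<le> 2 * beta_seq D \<beta> (Suc m)" for i m
  proof -
    show "bad2 i m \<in> events" unfolding bad2_def using bad1 by auto
    have "prob (bad2 i m) \<le> prob (bad1 i m 1) + prob (bad1 i m (-1))"
      unfolding bad2_def using bad1 by (intro measure_Un_le) auto
    then show "prob (bad2 i m) \<le> 2 * beta_seq D \<beta> (Suc m)"
      using bad1(2)[of 1 i m] bad1(2)[of "-1" i m] by simp
  qed
  have bad3: "(\<Union>m. bad2 i m) \<in> events" "prob (\<Union>m. bad2 i m) \<le> \<beta> / (2 ^ (D + 1) - 1)" for i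
  proof -
    show "(\<Union>m. bad2 i m) \<in> events" using bad2 by auto
    have sm: "summable (\<lambda>m. 2 * beta_seq D \<beta> (Suc m))" using beta_seq_sums by (rule sums_summable)
    have sb: "summable (\<lambda>m. prob (bad2 i m))"
      by (rule summable_comparison_test'[OF sm]) (use bad2 in auto)
    have "prob (\<Union>m. bad2 i m) \<le> (\<Sum>m. prob (bad2 i m))"
      using bad2 sb by (intro finite_measure_subadditive_countably) auto
    also have "\<dots> \<le> (\<Sum>m. 2 * beta_seq D \<beta> (Suc m))"
      using bad2 sb sm by (intro suminf_le) auto
    also have "\<dots> = \<beta> / (2 ^ (D + 1) - 1)" using beta_seq_sums by (rule sums_unique[symmetric])
    finally show "prob (\<Union>m. bad2 i m) \<le> \<beta> / (2 ^ (D + 1) - 1)" .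
  qed
  have V: "finite V" and cV: "real (card V) = 2 ^ (D + 1) - 1"
    using finite_nodes card_nodes[of D] by (auto simp: V_def of_nat_diff)
  show "bad \<in> events" unfolding bad_def using bad3 V by auto
  have "prob bad \<le> (\<Sum>i\<in>V. prob (\<Union>m. bad2 i m))"
    unfolding bad_def using bad3 V by (intro finite_measure_subadditive_finite) auto
  also have "\<dots> \<le> (\<Sum>i\<in>V. \<beta> / (2 ^ (D + 1) - 1))" using bad3 by (intro sum_mono) auto
  also have "\<dots> = \<beta>" using card_nodes_ge_1[of D] by (simp add: cV del: power_Suc)
  finally show "prob bad \<le> \<beta>" .
  fix \<omega> and i :: node and n assume \<omega>: "\<omega> \<in> space M - bad" and i: "length i \<le> D"
  show "\<bar>deviation i n \<omega>\<bar> \<le> conf D \<beta> (visits I i n \<omega>)"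
  proof (cases "visits I i n \<omega>")
    case 0
    then show ?thesis using rounds_eq_empty_iff[of I i n \<omega>] by (simp add: deviation_def)
  next
    case (Suc m)
    have "\<omega> \<notin> bad2 i m" using \<omega> i by (auto simp: bad_def V_def)
    then have "\<omega> \<notin> bad1 i m 1" "\<omega> \<notin> bad1 i m (-1)" by (auto simp: bad2_def)
    then have "deviation i n \<omega> \<le> conf D \<beta> (Suc m)" "- deviation i n \<omega> \<le> conf D \<beta> (Suc m)"
      using \<omega> Suc by (auto simp: bad1_def not_less)
    then show ?thesis by (simp add: Suc)
  qed
qed

lemma regret_bound:
  assumes \<beta>: "0 < \<beta>" "\<beta> \<le> 1" and B: "B = modified_uct_bound D \<beta>"
  shows "prob {\<omega> \<in> space M. \<forall>n\<ge>1. pseudo_regret D \<nu> I n \<omega> \<le> k_coeff D 0 * conf D \<beta> n + k'_coeff D 0} \<ge> 1 - \<beta>"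
    (is "prob ?good \<ge> _")
proof -
  obtain bad where bad: "bad \<in> events" "prob bad \<le> \<beta>"
    "\<And>\<omega> i n. \<omega> \<in> space M - bad \<Longrightarrow> length i \<le> D \<Longrightarrow>
      \<bar>deviation i n \<omega>\<bar> \<le> conf D \<beta> (visits I i n \<omega>)"
    using deviation_union_bound[OF \<beta>] by blast
  have "\<omega> \<in> ?good" if \<omega>: "\<omega> \<in> space M - bad" for \<omega>
  proof -
    have "pseudo_regret D \<nu> I n \<omega> \<le> k_coeff D 0 * conf D \<beta> n + k'_coeff D 0" for n
    proof -
      have "(\<Sum>t\<in>rounds I [] n \<omega>. node_value D \<nu> [] - leaf_value \<nu> (I t \<omega>))
          \<le> k_coeff D (length ([] :: node)) * conf D \<beta> (visits I [] n \<omega>) + k'_coeff D (length ([] :: node))"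
      proof (rule node_regret_bound[OF \<beta>])
        show "greedy_leaf D (\<lambda>j. modified_uct_bound D \<beta> j (visits I j (n - 1) \<omega>)
            (empirical_mean X I j (n - 1) \<omega>)) (I n \<omega>)" if "n \<ge> 1" for n
          using greedy[OF that, of \<omega>] \<omega> by (simp add: B)
      qed (use leaf_value_unit bad(3)[OF \<omega>] in \<open>auto simp: deviation_def\<close>)
      then show ?thesis using \<omega> by (simp add: pseudo_regret_eq visits_root)
    qed
    then show ?thesis using \<omega> by simp
  qed
  then have "space M - bad \<subseteq> ?good" by blast
  moreover have "?good \<in> events" by measurable
  ultimately have "prob (space M - bad) \<le> prob ?good" by (intro finite_measure_mono)
  then show ?thesis using bad by (simp add: prob_compl)
qed

end

theorem theorem1:
  fixes M :: "'w measure" and D :: nat and \<beta> :: real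
    and \<nu> :: "node \<Rightarrow> real measure"
    and X :: "node \<Rightarrow> nat \<Rightarrow> 'w \<Rightarrow> real"
    and S :: "'u measure" and U :: "'w \<Rightarrow> 'u"
    and I :: "nat \<Rightarrow> 'w \<Rightarrow> node"
  assumes "D \<ge> 1" and "\<beta> > 0"
    and "tree_bandit M D \<nu> X S U"
    and "tree_search_run M D (modified_uct_bound D \<beta>) X S U I"
  shows "measure M {\<omega> \<in> space M. \<forall>n\<ge>1.
           pseudo_regret D \<nu> I n \<omega> \<le>
             (1 + sqrt 2) / 2 * ((1 + sqrt 2) ^ D - 1) * sqrt (ln (inverse (beta_seq D \<beta> n)) * real n)
             + (3 ^ D - 1) / 2}
         \<ge> 1 - \<beta>"
proof (cases "\<beta> \<le> 1")
  case True
  interpret tree_search M D \<nu> X S U "modified_uct_bound D \<beta>" I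
    using assms by (simp add: tree_search_def tree_search_axioms_def)
  have "sqrt 2 * sqrt 2 = (2::real)" by simp
  then have "k_coeff D 0 * conf D \<beta> n
    = (1 + sqrt 2) / 2 * ((1 + sqrt 2) ^ D - 1) * sqrt (ln (inverse (beta_seq D \<beta> n)) * real n)" for n
    by (simp add: k_coeff_def conf_def real_sqrt_divide mult.commute mult.left_commute)
  moreover have "k'_coeff D 0 = (3 ^ D - 1) / 2" by (simp add: k'_coeff_def)
  ultimately show ?thesis
    using regret_bound[OF assms(2) True refl] by (simp only:)
next
  case False
  then have "1 - \<beta> \<le> 0" by simp
  then show ?thesis using measure_nonneg order_trans by blast
qed

end
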